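(* Let $\mathcal{L}$ be a uniform modular lattice of uniform-rank $n \geq 2$. Then the simplicial complex $\mathcal{C}(\mathcal{L})$ is an affine building of type A with dimension $n-1$.
   Context: Lattices. The length of a chain is its cardinality minus one; the rank $r[x,y]$ of an interval $[x,y]$ is the maximum length of a chain in it. Every lattice is assumed to satisfy the finiteness condition that every interval $[x,y]$ has finite rank. A lattice is modular if $(y \wedge z) \vee x = (x \vee z) \wedge y$ whenever $x \preceq y$. An element $y$ covers $x$ if $x \prec y$ and $[x,y]=\{x,y\}$. The ascending operator of a lattice $\mathcal{L}$ is $(x)^+ := \bigvee\{y \in \mathcal{L} \mid y \text{ covers } x\}$. A modular lattice $\mathcal{L}$ is uniform if $(x)^+$ exists for all $x \in \mathcal{L}$ and $x \mapsto (x)^+$ is an automorphism of the lattice $\mathcal{L}$. For $k\in\mathbf{Z}$, $(\cdot)^{+k}$ denotes the $k$-th power of this automorphism (negative $k$: powers of the inverse). The rank $r[x,(x)^+]$ is the same for all $x$, and is called the uniform-rank of $\mathcal{L}$. The complex $\mathcal{C}(\mathcal{L})$. A chain $x^0 \prec x^1 \prec \cdots \prec x^m$ in $\mathcal{L}$ is short if $x^m \preceq (x^0)^+$. Define $x \sim y$ if $(x)^{+k} = y$ for some $k \in \mathbf{Z}$. $\mathcal{C}(\mathcal{L})$ is the simplicial complex on the vertex set $\mathcal{L}/{\sim}$ whose simplices are the images modulo $\sim$ of the short chains of $\mathcal{L}$. Affine buildings of type A. A simplicial complex on a nonempty set $V$ is a family of subsets (simplices) of $V$ closed under taking subsets and containing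 all singletons; the dimension of a simplex $A$ is $|A|-1$, and that of the complex is the maximum dimension of a simplex. An isomorphism of simplicial complexes is a bijection of vertex sets preserving simplices in both directions. The affine Coxeter complex of type A (of dimension $n-1$) is the simplicial complex on $\mathbf{Z}^n/\mathbf{R}\mathbf{1}$ (integer vectors modulo the all-one vector $\mathbf{1}$) whose maximal simplices are the vertex sets $\{z, z+e_{\sigma(1)}, z+e_{\sigma(1)}+e_{\sigma(2)}, \ldots, z+e_{\sigma(1)}+\cdots+e_{\sigma(n-1)}\}$ modulo $\mathbf{R}\mathbf{1}$, for $z \in \mathbf{Z}^n$ and permutations $\sigma$ of $\{1,\ldots,n\}$. An affine building of type A is a simplicial complex $\Delta$ having a family of subcomplexes, called apartments, such that: (B1) each apartment is isomorphic to the affine Coxeter complex of type A; (B2) for any two simplices $A,B \in \Delta$ there is an apartment containing $A$ and $B$; (B3) if two apartments $\Sigma,\Sigma'$ both contain simplices $A,B$, then there is an isomorphism $\Sigma \to \Sigma'$ fixing $A$ and $B$ pointwise. *)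

theory Defs
  imports Complex_Main "HOL-Library.Lub_Glb" "HOL-Combinatorics.Permutations"
begin

section \<open>Uniform modular lattices\<close>

text \<open>
  A lattice is the universe of a type of class \<open>lattice\<close>; properties of the whole lattice take a
  type argument. The length of a chain is its cardinality minus one. The empty
  chain gets length 0 by truncation, which does not affect the rank of a nonempty interval.
\<close>

definition finite_rank_intervals :: "'a::lattice itself \<Rightarrow> bool" where
  "finite_rank_intervals T \<longleftrightarrow>
     (\<forall>x y :: 'a. x \<le> y \<longrightarrow>
        (\<exists>N. \<forall>C. C \<subseteq> {x..y} \<and> Complete_Partial_Order.chain (\<le>) C \<longrightarrow>
               finite C \<and> card C - 1 \<le> N))"

definition interval_rank :: "'a::lattice \<Rightarrow> 'a \<Rightarrow> nat" where
  "interval_rank x y =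
     Max {card C - 1 |C. C \<subseteq> {x..y} \<and> Complete_Partial_Order.chain (\<le>) C}"

definition modular_lattice :: "'a::lattice itself \<Rightarrow> bool" where
  "modular_lattice T \<longleftrightarrow>
     (\<forall>x y z :: 'a. x \<le> y \<longrightarrow> sup (inf y z) x = inf (sup x z) y)"

definition covers :: "'a::lattice \<Rightarrow> 'a \<Rightarrow> bool" where
  "covers y x \<longleftrightarrow> x < y \<and> {x..y} = {x, y}"

definition asc :: "'a::lattice \<Rightarrow> 'a" where
  "asc x = (THE u. isLub UNIV {y. covers y x} u)"

definition lattice_automorphism :: "('a::lattice \<Rightarrow> 'a) \<Rightarrow> bool" where
  "lattice_automorphism f \<longleftrightarrow>
     bij f \<and> (\<forall>x y. f (sup x y) = sup (f x) (f y) \<and> f (inf x y) = inf (f x) (f y))"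

definition uniform_modular_lattice :: "'a::lattice itself \<Rightarrow> bool" where
  "uniform_modular_lattice T \<longleftrightarrow>
     modular_lattice T \<and>
     (\<forall>x :: 'a. \<exists>u. isLub UNIV {y. covers y x} u) \<and>
     lattice_automorphism (asc :: 'a \<Rightarrow> 'a)"

text \<open>The common value of the rank of \<open>[x, asc x]\<close>.\<close>

definition uniform_rank :: "'a::lattice itself \<Rightarrow> nat" where
  "uniform_rank T = (THE r. \<forall>x :: 'a. interval_rank x (asc x) = r)"

definition asc_pow :: "int \<Rightarrow> 'a::lattice \<Rightarrow> 'a" where
  "asc_pow k = (if 0 \<le> k then asc ^^ nat k else inv asc ^^ nat (- k))"


section \<open>Simplicial complexes\<close>

definition simplicial_complex :: "'v set \<Rightarrow> 'v set set \<Rightarrow> bool" where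
  "simplicial_complex V \<Delta> \<longleftrightarrow>
     V \<noteq> {} \<and> \<Delta> \<subseteq> Pow V \<and> (\<forall>A\<in>\<Delta>. \<forall>B. B \<subseteq> A \<longrightarrow> B \<in> \<Delta>) \<and> (\<forall>v\<in>V. {v} \<in> \<Delta>)"

text \<open>As all singletons are simplices, the vertex set of a complex \<open>\<Sigma>\<close> is \<open>\<Union>\<Sigma>\<close>.\<close>

definition subcomplex :: "'v set set \<Rightarrow> 'v set set \<Rightarrow> bool" where
  "subcomplex \<Sigma> \<Delta> \<longleftrightarrow> \<Sigma> \<subseteq> \<Delta> \<and> simplicial_complex (\<Union>\<Sigma>) \<Sigma>"

definition complex_iso ::
  "'v set \<Rightarrow> 'v set set \<Rightarrow> 'w set \<Rightarrow> 'w set set \<Rightarrow> ('v \<Rightarrow> 'w) \<Rightarrow> bool" where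
  "complex_iso V \<Delta> W \<Gamma> f \<longleftrightarrow>
     bij_betw f V W \<and> (\<forall>A. A \<subseteq> V \<longrightarrow> (A \<in> \<Delta> \<longleftrightarrow> f ` A \<in> \<Gamma>))"

text \<open>The dimension is an \<open>int\<close> because the empty simplex has dimension \<open>-1\<close>.\<close>

definition has_dimension :: "'v set set \<Rightarrow> int \<Rightarrow> bool" where
  "has_dimension \<Delta> d \<longleftrightarrow>
     (\<forall>A\<in>\<Delta>. finite A \<and> int (card A) - 1 \<le> d) \<and>
     (\<exists>A\<in>\<Delta>. int (card A) - 1 = d)"


section \<open>The complex of a uniform modular lattice\<close>

definition asc_equiv :: "('a::lattice \<times> 'a) set" where
  "asc_equiv = {(x, y). \<exists>k. asc_pow k x = y}"

definition short_chain :: "'a::lattice list \<Rightarrow> bool" where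
  "short_chain xs \<longleftrightarrow> xs \<noteq> [] \<and> sorted_wrt (<) xs \<and> last xs \<le> asc (hd xs)"

definition lattice_complex_vertices :: "'a::lattice itself \<Rightarrow> 'a set set" where
  "lattice_complex_vertices T = UNIV // asc_equiv"

text \<open>
  Short chains are nonempty, so the empty simplex, which closure under subsets requires,
  is added separately.
\<close>

definition lattice_complex :: "'a::lattice itself \<Rightarrow> 'a set set set" where
  "lattice_complex T =
     insert {} {(\<lambda>x. asc_equiv `` {x}) ` set xs |xs :: 'a list. short_chain xs}"


section \<open>Affine buildings of type A\<close>

text \<open>Integer vectors of length \<open>n\<close> are functions vanishing outside the index set \<open>{1..n}\<close>.\<close>

definition int_vectors :: "nat \<Rightarrow> (nat \<Rightarrow> int) set" where
  "int_vectors n = {z. \<forall>i. i \<notin> {1..n} \<longrightarrow> z i = 0}"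

definition mod_ones :: "nat \<Rightarrow> ((nat \<Rightarrow> int) \<times> (nat \<Rightarrow> int)) set" where
  "mod_ones n = {(z, w). z \<in> int_vectors n \<and> w \<in> int_vectors n \<and>
     (\<exists>c::real. \<forall>i\<in>{1..n}. real_of_int (w i) = real_of_int (z i) + c)}"

definition coxeter_vertices :: "nat \<Rightarrow> (nat \<Rightarrow> int) set set" where
  "coxeter_vertices n = int_vectors n // mod_ones n"

definition unit_vec :: "nat \<Rightarrow> nat \<Rightarrow> int" where
  "unit_vec j = (\<lambda>i. if i = j then 1 else 0)"

definition coxeter_chamber :: "nat \<Rightarrow> (nat \<Rightarrow> int) \<Rightarrow> (nat \<Rightarrow> nat) \<Rightarrow> (nat \<Rightarrow> int) set set" where
  "coxeter_chamber n z \<sigma> =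
     {mod_ones n `` {\<lambda>i. z i + (\<Sum>j=1..k. unit_vec (\<sigma> j) i)} |k. k < n}"

definition coxeter_complex :: "nat \<Rightarrow> (nat \<Rightarrow> int) set set set" where
  "coxeter_complex n =
     {A. \<exists>z \<sigma>. z \<in> int_vectors n \<and> \<sigma> permutes {1..n} \<and> A \<subseteq> coxeter_chamber n z \<sigma>}"

text \<open>
  The parameter \<open>n\<close> is that of \<open>\<int>\<^sup>n\<close>: apartments are copies of the affine Coxeter complex of
  dimension \<open>n - 1\<close>.
\<close>

definition affine_building_A :: "nat \<Rightarrow> 'v set \<Rightarrow> 'v set set \<Rightarrow> bool" where
  "affine_building_A n V \<Delta> \<longleftrightarrow>
     simplicial_complex V \<Delta> \<and>
     (\<exists>\<A>. (\<forall>\<Sigma>\<in>\<A>. subcomplex \<Sigma> \<Delta>) \<and>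
       (\<forall>\<Sigma>\<in>\<A>. \<exists>f. complex_iso (\<Union>\<Sigma>) \<Sigma> (coxeter_vertices n) (coxeter_complex n) f) \<and>
       (\<forall>A\<in>\<Delta>. \<forall>B\<in>\<Delta>. \<exists>\<Sigma>\<in>\<A>. A \<in> \<Sigma> \<and> B \<in> \<Sigma>) \<and>
       (\<forall>\<Sigma>\<in>\<A>. \<forall>\<Sigma>'\<in>\<A>. \<forall>A B.
          A \<in> \<Sigma> \<and> B \<in> \<Sigma> \<and> A \<in> \<Sigma>' \<and> B \<in> \<Sigma>' \<longrightarrow>
          (\<exists>f. complex_iso (\<Union>\<Sigma>) \<Sigma> (\<Union>\<Sigma>') \<Sigma>' f \<and> (\<forall>v\<in>A \<union> B. f v = v))))"

end

theory Submission
  imports Defs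
begin

text \<open>
  The model to keep in mind is the lattice of full-rank \<open>O\<close>-submodules of \<open>K ^ n\<close>, where \<open>K\<close> is a
  field with a discrete valuation, \<open>O\<close> its valuation ring and \<open>t\<close> a uniformizer. There \<open>asc x\<close> is
  \<open>t\<^sup>-\<^sup>1 x\<close>, and a basis of \<open>K ^ n\<close> gives the embedding
  \<open>z \<mapsto> \<Oplus>\<^sub>i t ^ (- z\<^sub>i) O v\<^sub>i\<close> of \<open>\<int> ^ n\<close> into the lattice. In general, a \<^emph>\<open>skeleton\<close> is a lattice
  embedding of \<open>\<int> ^ n\<close> that turns translation by the all-one vector into \<open>asc\<close>, and the
  apartments are the images of the skeletons in the complex. The affine Coxeter complex is the
  complex of short chains of \<open>\<int> ^ n\<close>, so each apartment is a copy of it (\<open>vertex_map_iso\<close>).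

  All computations with joins and meets are reduced to counting by a global height function: in a
  modular lattice with finite ranks, saturated chains between the same end points have the same
  length, the resulting height satisfies \<open>height (sup x y) + height (inf x y) = height x + height y\<close>,
  and comparable elements of equal height coincide.

  A basis vector has no direct counterpart in the lattice. Its role is played by a \<^emph>\<open>ray\<close> from
  \<open>a\<close>, the abstract form of the chain \<open>a + t ^ (- m) O v\<close>, \<open>m = 0, 1, \<dots>\<close>. Rays can be
  built one step at a time, and \<open>n\<close> rays from \<open>a\<close> whose first steps join to \<open>asc a\<close> span a skeleton,
  whatever their later steps are (\<open>skeleton_of_rays\<close>): passing one step further along one ray raises
  the height of the join by at most one, and along the diagonal, where the join is a power of \<open>asc\<close>
  applied to \<open>a\<close>, no step may be lost.

  For two simplices to lie in one apartment, it must be possible to move a skeleton towards a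
  given chain without losing what it already contains. If \<open>c\<close> covers a point \<open>\<phi> u\<close> of a skeleton, then
  exchanging one ray gives a skeleton through \<open>c\<close> that agrees with \<open>\<phi>\<close> on an intersection of
  half-spaces through \<open>u\<close> (\<open>skeleton_exchange\<close>). This is the change of basis from \<open>v\<^sub>i\<close> to
  \<open>v\<^sub>i + \<Sum> \<lambda>\<^sub>j v\<^sub>j\<close>. There is a choice of \<open>i\<close>, and because a simplex never lies strictly on both
  sides of a wall \<open>z\<^sub>i - z\<^sub>j = const\<close>, one choice keeps a given simplex (\<open>skeleton_add_cover\<close>).
  Adding covers one after the other reaches any second simplex (\<open>common_skeleton\<close>).

  For the isomorphisms between apartments, each coordinate of a point of a skeleton is a difference
  of heights of meets with translates of the members of a chamber. Hence two skeletons
  that share a chamber assign the same coordinates to every point they have in common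
  (\<open>skeleton_coordinates_unique\<close>), and the isomorphism that respects coordinates fixes all common
  vertices. If two apartments merely share two simplices, a third one that contains a chamber around
  either simplex links them (\<open>apartments_iso\<close>).
\<close>


section \<open>Height in a modular lattice of finite rank\<close>

definition saturated :: "nat \<Rightarrow> 'a::lattice \<Rightarrow> 'a \<Rightarrow> bool" where
  "saturated k x y \<longleftrightarrow> (x, y) \<in> {(a, b). covers b a} ^^ k"

lemma covers_iff: "covers y x \<longleftrightarrow> x < y \<and> (\<forall>w. x \<le> w \<and> w \<le> y \<longrightarrow> w = x \<or> w = y)"
  unfolding covers_def by (auto simp: less_imp_le set_eq_iff)

lemma covers_less: "covers y x \<Longrightarrow> x < y"
  by (simp add: covers_def)

lemma covers_le: "covers y x \<Longrightarrow> x \<le> y"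
  by (simp add: covers_less less_imp_le)

lemma coversD: "covers y x \<Longrightarrow> x \<le> w \<Longrightarrow> w \<le> y \<Longrightarrow> w = x \<or> w = y"
  by (simp add: covers_iff)

lemma saturated_0 [simp]: "saturated 0 x y \<longleftrightarrow> x = y"
  by (auto simp: saturated_def)

lemma saturated_1: "saturated (Suc 0) x y \<longleftrightarrow> covers y x"
  by (auto simp: saturated_def)

lemma saturated_Suc: "saturated (Suc k) x y \<longleftrightarrow> (\<exists>c. covers c x \<and> saturated k c y)"
  unfolding saturated_def relpow.simps relpow_commute[symmetric] by blast

lemma saturated_add: "saturated j x y \<Longrightarrow> saturated k y z \<Longrightarrow> saturated (j + k) x z"
  by (auto simp: saturated_def relpow_add)

lemma saturated_le: "saturated k x y \<Longrightarrow> x \<le> y"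
  by (induction k arbitrary: x) (auto simp: saturated_Suc dest: covers_le intro: order_trans)

lemma saturated_refl: "saturated k x x \<Longrightarrow> k = 0"
  by (cases k) (auto simp: saturated_Suc dest!: covers_less saturated_le)

lemma saturated_covers: assumes "saturated k x y" "covers y x" shows "k = 1"
proof (cases k)
  case 0 then show ?thesis using assms by (auto simp: covers_def)
next
  case (Suc m)
  then obtain c where c: "covers c x" "saturated m c y" using assms by (auto simp: saturated_Suc)
  then have "c = y" using assms(2) by (metis coversD covers_less covers_le saturated_le less_irrefl)
  with c Suc show ?thesis using saturated_refl by auto
qed

locale finite_modular =
  fixes ty :: "'a::lattice itself"
  assumes modular: "modular_lattice ty"
    and finite_rank: "finite_rank_intervals ty"
begin

lemma modular_law: "(x::'a) \<le> y \<Longrightarrow> inf (sup x z) y = sup x (inf z y)"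
  using modular unfolding modular_lattice_def by (metis inf_commute sup_commute)

text \<open>
  Here \<open>inf b c = a\<close>, and by modularity an element \<open>w\<close> between \<open>b\<close> and \<open>sup b c\<close> is determined by
  \<open>inf c w\<close>, which lies between \<open>a\<close> and \<open>c\<close>.
\<close>

lemma covers_sup:
  fixes a b c :: 'a
  assumes "covers c a" "a \<le> b" "\<not> c \<le> b"
  shows "covers (sup b c) b"
  unfolding covers_iff
proof (intro conjI allI impI)
  show "b < sup b c" using assms(3) by (simp add: less_le_not_le)
  fix w assume w: "b \<le> w \<and> w \<le> sup b c"
  then have "w = sup b (inf c w)" using modular_law[of b w c] by (simp add: inf.absorb2)
  moreover have "inf c w = a \<or> inf c w = c"
    using coversD[OF assms(1)] assms(1,2) w by (meson covers_le inf_le1 le_infI order_trans)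
  ultimately show "w = b \<or> w = sup b c" using assms(2) by (metis sup.absorb1)
qed

text \<open>
  By modularity, \<open>inf _ b\<close> maps \<open>[a, sup a b]\<close> isomorphically onto \<open>[inf a b, b]\<close>, with inverse
  \<open>sup a\<close>; so it preserves covers.
\<close>

lemma covers_inf_transport:
  fixes a b p q :: 'a
  assumes "covers q p" "a \<le> p" "q \<le> sup a b"
  shows "covers (inf q b) (inf p b)"
proof -
  have p: "sup a (inf p b) = p" and q: "sup a (inf q b) = q"
    using modular_law[of a p b] modular_law[of a q b] assms covers_le[OF assms(1)]
    by (metis inf.absorb2 inf_commute order_trans)+
  show ?thesis unfolding covers_iff
  proof (intro conjI allI impI)
    show "inf p b < inf q b" using p q covers_less[OF assms(1)]
      by (metis covers_le[OF assms(1)] inf_mono order.refl order.not_eq_order_implies_strict less_irrefl)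
    fix w assume w: "inf p b \<le> w \<and> w \<le> inf q b"
    have "p \<le> sup a w" "sup a w \<le> q" using p q w by (metis sup_mono order.refl)+
    then have "sup a w = p \<or> sup a w = q" using coversD[OF assms(1)] by blast
    moreover have "w = inf (sup a w) b"
    proof -
      have "inf (sup w a) b = sup w (inf a b)" using w by (intro modular_law) auto
      moreover have "inf a b \<le> w" using w assms(2) by (meson inf_mono order.refl order_trans)
      ultimately show ?thesis by (simp add: sup.absorb1 sup_commute)
    qed
    ultimately show "w = inf p b \<or> w = inf q b" by metis
  qed
qed

lemma saturated_inf:
  fixes a b p q :: 'a
  shows "saturated k p q \<Longrightarrow> a \<le> p \<Longrightarrow> q \<le> sup a b \<Longrightarrow> saturated k (inf p b) (inf q b)"
proof (induction k arbitrary: p)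
  case (Suc k)
  then obtain c where c: "covers c p" "saturated k c q" by (auto simp: saturated_Suc)
  have "covers (inf c b) (inf p b)"
    using c Suc.prems saturated_le[OF c(2)] by (intro covers_inf_transport) (auto intro: order_trans)
  moreover have "saturated k (inf c b) (inf q b)"
    using c Suc.prems covers_le[OF c(1)] by (intro Suc.IH) (auto intro: order_trans)
  ultimately show ?case by (auto simp: saturated_Suc)
qed simp

text \<open>
  The Jordan-Dedekind property in the form needed for uniqueness of length. If the first element
  \<open>c\<close> of the chain is not below \<open>z\<close>, the induction hypothesis is applied at \<open>sup z c\<close>, and the part of
  the chain between \<open>c\<close> and \<open>sup z c\<close> is pulled back to a chain between \<open>x = inf c z\<close> and \<open>z\<close>.
\<close>

lemma saturated_split:
  fixes x y z :: 'a
  shows "saturated k x y \<Longrightarrow> x \<le> z \<Longrightarrow> z \<le> y \<Longrightarrow> \<exists>i j. k = i + j \<and> saturated i x z \<and> saturated j z y"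
proof (induction k arbitrary: x z)
  case (Suc k)
  then obtain c where c: "covers c x" "saturated k c y" by (auto simp: saturated_Suc)
  show ?case
  proof (cases "c \<le> z")
    case True
    then obtain i j where "k = i + j" "saturated i c z" "saturated j z y" using Suc c by blast
    then show ?thesis using c by (intro exI[of _ "Suc i"] exI[of _ j]) (auto simp: saturated_Suc)
  next
    case False
    have cz: "covers (sup z c) z" using covers_sup[OF c(1)] Suc.prems False by blast
    obtain i j where ij: "k = i + j" "saturated i c (sup z c)" "saturated j (sup z c) y"
      using Suc.IH[OF c(2), of "sup z c"] Suc.prems saturated_le[OF c(2)] by auto
    have "saturated i (inf c z) (inf (sup z c) z)" using saturated_inf[OF ij(2), of c z] by (simp add: sup_commute)
    moreover have "inf c z = x"
      using coversD[OF c(1), of "inf c z"] False c(1) Suc.prems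
      by (metis covers_le inf.cobounded1 inf.orderI inf_greatest)
    moreover have "inf (sup z c) z = z" by (simp add: inf.absorb2)
    ultimately show ?thesis using ij cz
      by (intro exI[of _ i] exI[of _ "Suc j"]) (auto simp: saturated_Suc)
  qed
qed simp

lemma saturated_unique: fixes x y :: 'a shows "saturated k x y \<Longrightarrow> saturated l x y \<Longrightarrow> k = l"
proof (induction k arbitrary: x l)
  case 0 then show ?case using saturated_refl by auto
next
  case (Suc k)
  then obtain c where c: "covers c x" "saturated k c y" by (auto simp: saturated_Suc)
  obtain i j where ij: "l = i + j" "saturated i x c" "saturated j c y"
    using saturated_split[OF Suc.prems(2)] c covers_le saturated_le by blast
  then show ?case using Suc.IH[OF c(2)] saturated_covers[OF ij(2) c(1)] by auto
qed

text \<open>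
  The induction is on a bound for the cardinality of chains: if \<open>z\<close> lies strictly between \<open>x\<close> and
  \<open>y\<close>, any chain in \<open>[x, z]\<close> can be enlarged by \<open>y\<close> and any chain in \<open>[z, y]\<close> by \<open>x\<close>, so the bound
  drops for both halves.
\<close>

lemma saturated_exists_bounded:
  fixes x y :: 'a
  shows "x \<le> y \<Longrightarrow> (\<And>C. C \<subseteq> {x..y} \<Longrightarrow> Complete_Partial_Order.chain (\<le>) C \<Longrightarrow> finite C \<and> card C \<le> N)
    \<Longrightarrow> \<exists>k. saturated k x y"
proof (induction N arbitrary: x y)
  case 0
  have "card {x} \<le> 0" using 0(1) 0(2)[of "{x}"] by (simp add: chain_def)
  then show ?case by simp
next
  case (Suc N)
  show ?case
  proof (cases "x = y \<or> covers y x")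
    case True then show ?thesis by (metis saturated_0 saturated_1)
  next
    case False
    then obtain z where z: "x < z" "z < y" using Suc.prems(1)
      by (auto simp: covers_iff order.order_iff_strict)
    have "\<exists>k. saturated k x z"
    proof (rule Suc.IH)
      fix C assume C: "C \<subseteq> {x..z}" "Complete_Partial_Order.chain (\<le>) C"
      have "finite (insert y C) \<and> card (insert y C) \<le> Suc N"
        using C z by (intro Suc.prems(2)) (auto simp: chain_def subset_iff intro: order_trans less_imp_le)
      moreover have "y \<notin> C" using C(1) z(2) by (meson atLeastAtMost_iff subsetD leD)
      ultimately show "finite C \<and> card C \<le> N" by auto
    qed (use z in auto)
    moreover have "\<exists>k. saturated k z y"
    proof (rule Suc.IH)
      fix C assume C: "C \<subseteq> {z..y}" "Complete_Partial_Order.chain (\<le>) C"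
      have "finite (insert x C) \<and> card (insert x C) \<le> Suc N"
        using C z by (intro Suc.prems(2)) (auto simp: chain_def subset_iff intro: order_trans less_imp_le)
      moreover have "x \<notin> C" using C(1) z(1) by (meson atLeastAtMost_iff subsetD leD)
      ultimately show "finite C \<and> card C \<le> N" by auto
    qed (use z in auto)
    ultimately show ?thesis using saturated_add by blast
  qed
qed

lemma saturated_exists: fixes x y :: 'a assumes "x \<le> y" shows "\<exists>k. saturated k x y"
proof -
  obtain N where N: "\<And>C. C \<subseteq> {x..y} \<and> Complete_Partial_Order.chain (\<le>) C \<Longrightarrow> finite C \<and> card C - 1 \<le> N"
    using finite_rank assms unfolding finite_rank_intervals_def by meson
  show ?thesis
  proof (rule saturated_exists_bounded[OF assms])
    fix C assume "C \<subseteq> {x..y}" "Complete_Partial_Order.chain (\<le>) C"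
    then show "finite C \<and> card C \<le> Suc N" using N[of C] by auto
  qed
qed

lemma cover_between: fixes x y :: 'a assumes "x < y" shows "\<exists>c. covers c x \<and> c \<le> y"
proof -
  obtain k where "saturated k x y" using saturated_exists assms less_imp_le by blast
  then show ?thesis using assms by (cases k) (auto simp: saturated_Suc dest: saturated_le)
qed

definition rk :: "'a \<Rightarrow> 'a \<Rightarrow> nat" where
  "rk x y = (THE k. saturated k x y)"

lemma rk_eqI: "saturated k x y \<Longrightarrow> rk x y = k"
  unfolding rk_def using saturated_unique by blast

lemma saturated_rk: "x \<le> y \<Longrightarrow> saturated (rk x y) x y"
  using saturated_exists rk_eqI by metis

lemma rk_add: "x \<le> y \<Longrightarrow> y \<le> z \<Longrightarrow> rk x z = rk x y + rk y z"
  by (rule rk_eqI[OF saturated_add[OF saturated_rk saturated_rk]])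

lemma rk_diamond: "rk (inf a b) b = rk a (sup a b)"
  using saturated_inf[OF saturated_rk, of a "sup a b" a b] by (intro rk_eqI) (simp add: inf.absorb2)

text \<open>
  The rank relative to a base point, for which any element serves. As the base point need not lie
  below \<open>x\<close>, the value is taken through its meet with \<open>x\<close> and may be negative.
\<close>

definition height :: "'a \<Rightarrow> int" where
  "height x = int (rk (inf undefined x) x) - int (rk (inf undefined x) undefined)"

lemma height_diff: assumes "x \<le> y" shows "height y = height x + int (rk x y)"
proof -
  define base :: 'a where "base = undefined"
  define p where "p = inf base x"
  have le: "p \<le> inf base y" "inf base y \<le> y" "inf base y \<le> base" "p \<le> x"
    using assms by (auto simp: p_def intro: le_infI2)
  have "rk p y = rk p (inf base y) + rk (inf base y) y" "rk p base = rk p (inf base y) + rk (inf base y) base"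
    "rk p y = rk p x + rk x y"
    using le assms by (auto intro!: rk_add)
  then show ?thesis unfolding height_def base_def[symmetric] p_def[symmetric] by linarith
qed

lemma height_saturated: "saturated k x y \<Longrightarrow> height y = height x + int k"
  using height_diff rk_eqI saturated_le by metis

lemma height_covers: "covers y x \<Longrightarrow> height y = height x + 1"
  using height_saturated[of 1 x y] by (simp add: saturated_1)

lemma height_mono: "x \<le> y \<Longrightarrow> height x \<le> height y"
  using height_diff by fastforce

lemma height_le_eq: "x \<le> y \<Longrightarrow> height y \<le> height x \<Longrightarrow> x = y"
  using height_diff[of x y] saturated_rk[of x y] by simp

lemma height_strict: "x < y \<Longrightarrow> height x < height y"
  using height_le_eq by (metis less_le not_le)

lemma height_coversI: assumes "x \<le> y" "height y = height x + 1" shows "covers y x"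
  using height_diff[OF assms(1)] saturated_rk[OF assms(1)] assms(2) by (simp add: saturated_1)

lemma height_sup_inf: "height (sup x y) + height (inf x y) = height x + height y"
  using height_diff[of x "sup x y"] height_diff[of "inf x y" y] rk_diamond[of x y] by simp

text \<open>
  Heights are injective on a chain, which bounds the cardinality of chains; a saturated
  chain attains the bound.
\<close>

lemma interval_rank_eq: assumes "x \<le> y" shows "int (interval_rank x y) = height y - height x"
proof -
  define R where "R = {card C - 1 |C. C \<subseteq> {x..y} \<and> Complete_Partial_Order.chain (\<le>) C}"
  have up: "finite C \<and> card C - 1 \<le> rk x y"
    if C: "C \<subseteq> {x..y}" "Complete_Partial_Order.chain (\<le>) C" for C
  proof -
    have inj: "inj_on height C" using C(2) height_le_eq unfolding chain_def inj_on_def by (metis order.refl)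
    have sub: "height ` C \<subseteq> {height x..height y}" using C(1) height_mono by force
    have "finite C" using finite_imageD[OF finite_subset[OF sub] inj] by simp
    moreover have "card C \<le> card {height x..height y}" using card_inj_on_le[OF inj sub] by simp
    ultimately show ?thesis using height_diff[OF assms] by simp
  qed
  have ex: "\<exists>C. C \<subseteq> {x..y} \<and> Complete_Partial_Order.chain (\<le>) C \<and> finite C \<and> card C = Suc k"
    if "saturated k x y" for k x and y :: 'a
    using that
  proof (induction k arbitrary: x)
    case 0 then show ?case by (intro exI[of _ "{x}"]) (auto simp: chain_def)
  next
    case (Suc k)
    then obtain c where c: "covers c x" "saturated k c y" by (auto simp: saturated_Suc)
    then obtain C where C: "C \<subseteq> {c..y}" "Complete_Partial_Order.chain (\<le>) C" "finite C" "card C = Suc k"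
      using Suc.IH by blast
    have lt: "x < c'" if "c' \<in> C" for c'
      using C(1) covers_less[OF c(1)] that
      by (meson atLeastAtMost_iff less_le_trans subsetD)
    then have "x \<notin> C" by auto
    moreover have "x \<le> y" using saturated_le Suc.prems by blast
    moreover have "Complete_Partial_Order.chain (\<le>) (insert x C)"
      using C(2) lt unfolding chain_def by (auto intro: less_imp_le)
    moreover have "insert x C \<subseteq> {x..y}"
    proof
      fix w assume "w \<in> insert x C"
      then show "w \<in> {x..y}"
        using subsetD[OF C(1), of w] lt[of w] \<open>x \<le> y\<close> by (auto simp: less_imp_le)
    qed
    ultimately show ?case using C by (intro exI[of _ "insert x C"]) auto
  qed
  have "Max R = rk x y"
  proof (rule Max_eqI)
    show "finite R" by (rule finite_subset[of _ "{..rk x y}"]) (use up in \<open>auto simp: R_def\<close>)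
    obtain C where "C \<subseteq> {x..y}" "Complete_Partial_Order.chain (\<le>) C" "card C = Suc (rk x y)"
      using ex[OF saturated_rk[OF assms]] by blast
    then show "rk x y \<in> R" unfolding R_def by (intro CollectI exI[of _ C]) simp
  qed (use up in \<open>auto simp: R_def\<close>)
  then show ?thesis using height_diff[OF assms] by (simp add: interval_rank_def R_def)
qed

end

section \<open>The ascending operator\<close>

locale uniform_modular = finite_modular ty for ty :: "'a::lattice itself" +
  fixes n :: nat
  assumes uniform: "uniform_modular_lattice ty"
    and rank_n: "uniform_rank ty = n"
    and n_pos: "1 \<le> n"
begin

lemma asc_le_iff: fixes x :: 'a shows "asc x \<le> b \<longleftrightarrow> (\<forall>c. covers c x \<longrightarrow> c \<le> b)"
proof -
  obtain u where u: "isLub UNIV {y. covers y x} u"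
    using uniform unfolding uniform_modular_lattice_def by blast
  have "asc x = u" unfolding asc_def
    by (intro the_equality u order.antisym)
      (use u in \<open>auto simp: isLub_def leastP_def setge_def\<close>)
  then show ?thesis using u
    by (auto simp: isLub_def leastP_def setge_def isUb_def setle_def intro: order_trans)
qed

lemma covers_le_asc: fixes x :: 'a shows "covers c x \<Longrightarrow> c \<le> asc x"
  using asc_le_iff by blast

lemma bij_asc: "bij (asc :: 'a \<Rightarrow> 'a)"
  and asc_sup: "asc (sup x y) = sup (asc x) (asc (y :: 'a))"
  using uniform by (auto simp: uniform_modular_lattice_def lattice_automorphism_def)

lemma asc_eq_iff [simp]: "asc x = asc y \<longleftrightarrow> x = (y :: 'a)"
  using bij_asc by (meson bij_def inj_eq)

lemma asc_mono_iff [simp]: "asc x \<le> asc y \<longleftrightarrow> x \<le> (y :: 'a)"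
  by (metis asc_eq_iff asc_sup sup.absorb_iff2)

lemma asc_surjE: obtains y :: 'a where "x = asc y"
  using bij_asc by (meson bij_def surjD)

lemma covers_asc: fixes x y :: 'a assumes "covers y x" shows "covers (asc y) (asc x)"
  unfolding covers_iff
proof (intro conjI allI impI)
  show "asc x < asc y" using covers_less[OF assms] by (simp add: less_le_not_le)
  fix w assume w: "asc x \<le> w \<and> w \<le> asc y"
  obtain v where "w = asc v" by (rule asc_surjE)
  then show "w = asc x \<or> w = asc y" using coversD[OF assms, of v] w by auto
qed

lemma saturated_asc: fixes x y :: 'a shows "saturated k x y \<Longrightarrow> saturated k (asc x) (asc y)"
  by (induction k arbitrary: x) (auto simp: saturated_Suc intro: covers_asc)

lemma height_asc_diff: "height (asc x) - height x = height (asc y) - height y"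
proof -
  have "height (asc x) - height x = height (asc y) - height y" if "x \<le> y" for x y
    using height_saturated[OF saturated_rk[OF that]] height_saturated[OF saturated_asc[OF saturated_rk[OF that]]] by simp
  from this[of "inf x y" x] this[of "inf x y" y] show ?thesis by simp
qed

text \<open>
  An element without covers has the join of the empty set, the least element of the lattice, as its
  \<open>asc\<close>. Injectivity of \<open>asc\<close> then forces the element to be fixed.
\<close>

lemma le_asc: "(x :: 'a) \<le> asc x"
proof (cases "\<exists>c. covers c x")
  case True then show ?thesis using covers_le_asc covers_le order_trans by blast
next
  case False
  then have bot: "asc x \<le> b" for b using asc_le_iff by blast
  then have "asc (asc x) \<le> asc x" using asc_mono_iff by blast
  then have "asc x = x" using bot by (metis asc_eq_iff order.antisym)
  then show ?thesis by simp
qed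

text \<open>
  The height difference between \<open>x\<close> and \<open>asc x\<close> does not depend on \<open>x\<close>: for \<open>x \<le> y\<close> the
  automorphism \<open>asc\<close> maps \<open>[x, y]\<close> to \<open>[asc x, asc y]\<close>, and two elements are compared through their
  meet. So the uniform rank is well-defined and equals this difference.
\<close>

lemma height_asc: "height (asc x) = height x + int n"
proof -
  have eq: "interval_rank y (asc y) = interval_rank x (asc x)" for y :: 'a
    using interval_rank_eq[OF le_asc, of x] interval_rank_eq[OF le_asc, of y] height_asc_diff[of x y] by simp
  have "uniform_rank ty = interval_rank x (asc x)" unfolding uniform_rank_def
  proof (rule the_equality)
    show "\<forall>y::'a. interval_rank y (asc y) = interval_rank x (asc x)" using eq by blast
  qed auto
  then show ?thesis using interval_rank_eq[OF le_asc, of x] rank_n by simp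
qed

lemma asc_pow_0 [simp]: "asc_pow 0 x = (x :: 'a)"
  by (simp add: asc_pow_def)

lemma asc_pow_Suc: "asc_pow (k + 1) x = asc (asc_pow k (x :: 'a))"
proof (cases "0 \<le> k")
  case True
  then have "nat (k + 1) = Suc (nat k)" by simp
  then show ?thesis using True by (simp add: asc_pow_def)
next
  case False
  define m where "m = nat (- (k + 1))"
  have "nat (- k) = Suc m" using False by (simp add: m_def)
  then have "asc (asc_pow k x) = (inv asc ^^ m) x"
    using False bij_asc by (simp add: asc_pow_def surj_f_inv_f bij_def)
  also have "\<dots> = asc_pow (k + 1) x"
    using False by (cases "k + 1 = 0") (auto simp: asc_pow_def m_def)
  finally show ?thesis by simp
qed

lemma asc_pow_add: "asc_pow (j + k) x = asc_pow j (asc_pow k (x :: 'a))"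
proof (induction j rule: int_induct[where k = 0])
  case (step1 j)
  have "asc_pow (j + 1 + k) x = asc (asc_pow (j + k) x)"
    using asc_pow_Suc[of "j + k"] by (simp add: algebra_simps)
  then show ?case using step1 asc_pow_Suc by simp
next
  case (step2 j)
  have "asc (asc_pow (j - 1 + k) x) = asc_pow (j + k) x"
    using asc_pow_Suc[of "j - 1 + k" x] by (simp add: algebra_simps)
  moreover have "asc (asc_pow (j - 1) (asc_pow k x)) = asc_pow j (asc_pow k x)"
    using asc_pow_Suc[of "j - 1" "asc_pow k x"] by simp
  ultimately show ?case using step2 by (metis asc_eq_iff)
qed simp

lemma asc_pow_1: "asc_pow 1 x = asc (x :: 'a)"
  using asc_pow_Suc[of 0 x] by simp

lemma asc_pow_cancel [simp]:
  "asc_pow (- k) (asc_pow k x) = (x :: 'a)" "asc_pow k (asc_pow (- k) x) = (x :: 'a)"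
  using asc_pow_add[of "- k" k x] asc_pow_add[of k "- k" x] by simp_all

lemma asc_pow_le_iff [simp]: "asc_pow k x \<le> asc_pow k y \<longleftrightarrow> x \<le> (y :: 'a)"
proof (induction k rule: int_induct[where k = 0])
  case (step1 j) then show ?case by (simp add: asc_pow_Suc)
next
  case (step2 j) then show ?case
    using asc_pow_Suc[of "j - 1" x] asc_pow_Suc[of "j - 1" y] by simp
qed simp

lemma asc_pow_eq_iff [simp]: "asc_pow k x = asc_pow k y \<longleftrightarrow> x = (y :: 'a)"
  by (metis asc_pow_cancel(1))

lemma asc_pow_le_shift: "asc_pow k x \<le> y \<longleftrightarrow> x \<le> asc_pow (- k) (y :: 'a)"
  by (metis asc_pow_cancel(2) asc_pow_le_iff)

lemma asc_pow_sup: "asc_pow k (sup x y) = sup (asc_pow k x) (asc_pow k (y :: 'a))"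
proof (intro order.antisym)
  show "asc_pow k (sup x y) \<le> sup (asc_pow k x) (asc_pow k y)"
    unfolding asc_pow_le_shift[of k "sup x y"]
    by (rule le_supI) (simp_all flip: asc_pow_le_shift)
qed simp_all

lemma asc_pow_inf: "asc_pow k (inf x y) = inf (asc_pow k x) (asc_pow k (y :: 'a))"
proof (intro order.antisym)
  have "asc_pow (- k) (inf (asc_pow k x) (asc_pow k y)) \<le> inf x y"
    by (rule le_infI) (simp_all add: asc_pow_le_shift)
  then show "inf (asc_pow k x) (asc_pow k y) \<le> asc_pow k (inf x y)"
    using asc_pow_le_shift[of "- k" _ "inf x y"] by simp
qed simp_all

lemma asc_pow_commute: "asc_pow k (asc x) = asc (asc_pow k (x :: 'a))"
  by (metis asc_pow_Suc asc_pow_1 asc_pow_add)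

lemma height_asc_pow: "height (asc_pow k x) = height x + k * int n"
proof (induction k rule: int_induct[where k = 0])
  case (step1 j) then show ?case by (simp only: asc_pow_Suc height_asc) (simp add: algebra_simps)
next
  case (step2 j) then show ?case
    using asc_pow_Suc[of "j - 1" x] height_asc[of "asc_pow (j - 1) x"] by (simp add: algebra_simps)
qed simp

text \<open>
  Every member of a saturated chain is below \<open>asc\<close> of its predecessor.
\<close>

lemma le_asc_pow: "(x :: 'a) \<le> y \<Longrightarrow> \<exists>k. y \<le> asc_pow (int k) x"
proof -
  assume "x \<le> y"
  moreover have "saturated k x y \<Longrightarrow> y \<le> asc_pow (int k) x" for k and x y :: 'a
  proof (induction k arbitrary: x)
    case (Suc k)
    then obtain c where c: "covers c x" "saturated k c y" by (auto simp: saturated_Suc)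
    have "y \<le> asc_pow (int k) c" using Suc.IH c by blast
    also have "\<dots> \<le> asc_pow (int k) (asc x)" using covers_le_asc[OF c(1)] by simp
    also have "\<dots> = asc_pow (int (Suc k)) x"
      using asc_pow_Suc[of "int k" x] by (simp add: asc_pow_commute add.commute)
    finally show ?case .
  qed simp
  ultimately show ?thesis using saturated_exists by blast
qed

text \<open>
  The interval \<open>[x, asc x]\<close> is atomistic because \<open>asc x\<close> is the join of the covers of \<open>x\<close>. Concretely,
  an element \<open>t\<close> of maximal height that meets \<open>inf g s\<close> in \<open>x\<close> is a complement of \<open>inf g s\<close>; by
  modularity \<open>inf t g\<close> is a complement of it inside \<open>[x, g]\<close>, and any cover of \<open>x\<close> below \<open>inf t g\<close>
  avoids \<open>s\<close>.
\<close>

lemma cover_choice: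
  fixes x g s :: 'a
  assumes g: "x \<le> g" "g \<le> asc x" and s: "x \<le> s" "\<not> g \<le> s"
  shows "\<exists>h. covers h x \<and> h \<le> g \<and> \<not> h \<le> s"
proof -
  define b where "b = inf g s"
  define Q where "Q t \<longleftrightarrow> x \<le> t \<and> t \<le> asc x \<and> inf t b = x" for t
  have b: "x \<le> b" "b \<le> g" "b \<le> s" using g s by (auto simp: b_def)
  have "Q x" using b le_asc by (simp add: Q_def inf.absorb1)
  moreover have "\<forall>t. Q t \<longrightarrow> nat (height t - height x) < Suc n"
    using height_mono height_asc by (fastforce simp: Q_def)
  ultimately obtain t where t: "Q t" and max: "\<And>t'. Q t' \<Longrightarrow> nat (height t' - height x) \<le> nat (height t - height x)"
    using ex_has_greatest_nat[of Q x "\<lambda>t. nat (height t - height x)"] by blast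
  have "asc x \<le> sup t b" unfolding asc_le_iff
  proof (intro allI impI, rule ccontr)
    fix h assume h: "covers h x" "\<not> h \<le> sup t b"
    have "inf h (sup t b) = x"
      using coversD[OF h(1), of "inf h (sup t b)"] h covers_le[OF h(1)] b
      by (metis inf.cobounded1 inf.cobounded2 le_infI le_supI2)
    then have "inf (sup t h) (sup t b) = t"
      using modular_law[of t "sup t b" h] t by (simp add: Q_def sup.absorb1)
    then have "inf (sup t h) b \<le> inf t b"
      by (metis inf.cobounded2 inf_mono le_inf_iff order.refl sup.cobounded2)
    moreover have "x \<le> inf (sup t h) b" using t b by (simp add: Q_def le_supI1)
    ultimately have "Q (sup t h)"
      using t covers_le_asc[OF h(1)] by (auto simp: Q_def le_supI1 intro: order.antisym)
    moreover have "t < sup t h" using h(2) by (metis le_supI1 sup.cobounded1 sup.cobounded2 order.not_eq_order_implies_strict)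
    ultimately show False using max height_strict[of t "sup t h"] height_mono[of x t] t by (force simp: Q_def)
  qed
  moreover have "sup t b \<le> asc x" using t b g by (auto simp: Q_def)
  ultimately have "g = sup b (inf t g)"
    using modular_law[OF b(2), of t] g by (simp add: sup_commute inf.absorb2)
  then have "inf t g \<noteq> x" using b s by (metis sup.absorb1)
  then have "x < inf t g" using t g by (simp add: Q_def order.not_eq_order_implies_strict)
  then obtain h where h: "covers h x" "h \<le> inf t g" using cover_between by blast
  have "h \<le> s \<Longrightarrow> h \<le> x" using h t by (metis Q_def b_def le_inf_iff)
  then show ?thesis using h covers_less[OF h(1)] by (auto simp: less_le_not_le)
qed


section \<open>Rays and skeletons\<close>

text \<open>
  In the lattice of \<open>O\<close>-modules, \<open>\<rho> m = a + t ^ (- m) O v\<close> with \<open>v\<close> in \<open>a\<close> but not in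
  \<open>t a\<close>. The last condition says
  that the step from \<open>\<rho> (m + 1)\<close> to \<open>\<rho> (m + 2)\<close> continues in the direction of the previous step:
  \<open>\<rho> (m + 2) / \<rho> m\<close> is not killed by \<open>t\<close>.
\<close>

definition ray :: "'a \<Rightarrow> (nat \<Rightarrow> 'a) \<Rightarrow> bool" where
  "ray a \<rho> \<longleftrightarrow> \<rho> 0 = a \<and> (\<forall>m. covers (\<rho> (Suc m)) (\<rho> m)) \<and> (\<forall>m. \<not> \<rho> (Suc (Suc m)) \<le> asc (\<rho> m))"

lemma ray_mono: "ray a \<rho> \<Longrightarrow> i \<le> j \<Longrightarrow> \<rho> i \<le> \<rho> j"
  by (rule lift_Suc_mono_le) (auto simp: ray_def covers_le)

text \<open>
  For modules, \<open>t\<^sup>-\<^sup>1 (a + t ^ (- m) O v)\<close> is the sum of \<open>a + t ^ (- m - 1) O v\<close> and \<open>t\<^sup>-\<^sup>1 a\<close>. In the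
  lattice, the join lies between \<open>asc (\<rho> m)\<close>, by induction, and \<open>asc (\<rho> (m + 1))\<close>, which covers it;
  the ray condition excludes the lower end.
\<close>

lemma ray_asc: assumes "ray a \<rho>" shows "sup (\<rho> (Suc m)) (asc a) = asc (\<rho> m)"
proof (induction m)
  case 0 then show ?case using assms covers_le_asc by (auto simp: ray_def sup.absorb2)
next
  case (Suc m)
  define s where "s = sup (\<rho> (Suc (Suc m))) (asc a)"
  have cov: "covers (\<rho> (Suc (Suc m))) (\<rho> (Suc m))" "covers (asc (\<rho> (Suc m))) (asc (\<rho> m))"
    using assms covers_asc by (auto simp: ray_def)
  have "asc (\<rho> m) \<le> s" unfolding s_def Suc[symmetric] using covers_le[OF cov(1)] by (simp add: le_supI1)
  moreover have "a \<le> \<rho> (Suc m)" using ray_mono[OF assms, of 0 "Suc m"] assms by (simp add: ray_def)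
  then have "s \<le> asc (\<rho> (Suc m))" using covers_le_asc[OF cov(1)] by (simp add: s_def)
  ultimately have "s = asc (\<rho> m) \<or> s = asc (\<rho> (Suc m))" using coversD[OF cov(2)] by blast
  moreover have "\<rho> (Suc (Suc m)) \<le> s" by (simp add: s_def)
  then have "s \<noteq> asc (\<rho> m)" using assms by (auto simp: ray_def)
  ultimately show ?case by (simp add: s_def)
qed

text \<open>
  The bounds \<open>G\<close> confine the ray. In the next step one needs a cover of \<open>r = \<rho> (m + 1)\<close> below
  \<open>g = inf (asc r) (G (m + 1))\<close> and not below \<open>asc r'\<close>, where \<open>r' = \<rho> m\<close>. It exists by \<open>cover_choice\<close> because
  \<open>g\<close> is not below \<open>asc r'\<close>: the second hypothesis on \<open>G\<close> and modularity give \<open>asc r = sup (asc a) g\<close>,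
  and \<open>asc a \<le> asc r'\<close>.
\<close>

lemma ray_exists:
  fixes a c :: 'a
  assumes c: "covers c a" "c \<le> G 0"
    and G: "\<And>m. G m \<le> G (Suc m)" "\<And>m. asc (G m) \<le> sup (G (Suc m)) (asc a)"
  shows "\<exists>\<rho>. ray a \<rho> \<and> \<rho> 1 = c \<and> (\<forall>m. \<rho> (Suc m) \<le> G m)"
proof -
  define P where "P m p \<longleftrightarrow> a \<le> fst p \<and> covers (snd p) (fst p) \<and> snd p \<le> G m \<and> (m = 0 \<longrightarrow> p = (a, c))"
    for m :: nat and p :: "'a \<times> 'a"
  define Q where "Q p q \<longleftrightarrow> fst q = snd p \<and> \<not> snd q \<le> asc (fst p)" for p q :: "'a \<times> 'a"
  have "\<exists>f. \<forall>m. P m (f m) \<and> Q (f m) (f (Suc m))"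
  proof (rule dependent_nat_choice)
    show "\<exists>p. P 0 p" using c by (auto simp: P_def)
    fix p m assume P: "P m p"
    define r r' where "r = snd p" and "r' = fst p"
    have r: "covers r r'" "a \<le> r'" "r \<le> G m" using P by (auto simp: P_def r_def r'_def)
    define g where "g = inf (asc r) (G (Suc m))"
    have "asc r \<le> sup (G (Suc m)) (asc a)" using r(3) G(2) by (meson asc_mono_iff order_trans)
    moreover have "asc a \<le> asc r" using r covers_le[OF r(1)] by (simp add: order_trans[of a r'])
    then have "inf (sup (asc a) (G (Suc m))) (asc r) = sup (asc a) g"
      unfolding g_def by (metis modular_law inf_commute)
    ultimately have "asc r = sup (asc a) g" by (simp add: inf.absorb2 sup_commute)
    moreover have "asc a \<le> asc r'" "\<not> asc r \<le> asc r'"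
      using r covers_less[OF r(1)] by (auto simp: less_le_not_le)
    ultimately have "\<not> g \<le> asc r'" by auto
    moreover have "r \<le> g" using r G(1)[of m] le_asc[of r] by (simp add: g_def order_trans)
    ultimately obtain h where "covers h r" "h \<le> g" "\<not> h \<le> asc r'"
      using cover_choice[of r g "asc r'"] covers_le_asc[OF r(1)] by (auto simp: g_def)
    then have "P (Suc m) (r, h) \<and> Q p (r, h)" using r covers_le[OF r(1)]
      by (auto simp: P_def Q_def g_def r_def r'_def)
    then show "\<exists>q. P (Suc m) q \<and> Q p q" by blast
  qed
  then obtain f where f: "\<And>m. P m (f m)" "\<And>m. Q (f m) (f (Suc m))" by blast
  define \<rho> where "\<rho> m = fst (f m)" for m
  have Suc: "\<rho> (Suc m) = snd (f m)" for m using f(2) by (simp add: Q_def \<rho>_def)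
  have "\<rho> 0 = a" "\<rho> 1 = c" using f(1)[of 0] Suc[of 0] by (auto simp: P_def \<rho>_def)
  moreover have "covers (\<rho> (Suc m)) (\<rho> m)" "\<rho> (Suc m) \<le> G m" for m
    using f(1)[of m] unfolding Suc by (auto simp: P_def \<rho>_def)
  moreover have "\<not> \<rho> (Suc (Suc m)) \<le> asc (\<rho> m)" for m
    using f(2)[of m] unfolding Suc by (auto simp: Q_def \<rho>_def)
  ultimately show ?thesis by (auto simp: ray_def)
qed

text \<open>
  Integer vectors are taken as arbitrary functions whose values outside \<open>{1..n}\<close> are ignored, which
  spares side conditions on supports; \<open>truncate\<close> below returns to vectors of length \<open>n\<close>. The height
  condition carries injectivity.
\<close>

definition skeleton :: "((nat \<Rightarrow> int) \<Rightarrow> 'a) \<Rightarrow> bool" where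
  "skeleton \<phi> \<longleftrightarrow>
     (\<forall>z w. (\<forall>i\<in>{1..n}. z i = w i) \<longrightarrow> \<phi> z = \<phi> w) \<and>
     (\<forall>z w. \<phi> (\<lambda>i. max (z i) (w i)) = sup (\<phi> z) (\<phi> w)) \<and>
     (\<forall>z w. \<phi> (\<lambda>i. min (z i) (w i)) = inf (\<phi> z) (\<phi> w)) \<and>
     (\<forall>z. \<phi> (\<lambda>i. z i + 1) = asc (\<phi> z)) \<and>
     (\<forall>z. height (\<phi> z) = height (\<phi> (\<lambda>_. 0)) + (\<Sum>i=1..n. z i))"

end

text \<open>
  The second assumption says that the join of the first steps of the rays is above \<open>asc a\<close>; in terms of
  modules, the reductions of the vectors generate \<open>t\<^sup>-\<^sup>1 a / a\<close>.
\<close>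

locale ray_frame = uniform_modular ty n for ty :: "'a::lattice itself" and n +
  fixes a :: 'a and \<rho> :: "nat \<Rightarrow> nat \<Rightarrow> 'a"
  assumes rays: "\<And>i. i \<in> {1..n} \<Longrightarrow> ray a (\<rho> i)"
    and indep: "\<And>b. (\<And>i. i \<in> {1..n} \<Longrightarrow> \<rho> i 1 \<le> b) \<Longrightarrow> asc a \<le> b"
begin

definition join :: "(nat \<Rightarrow> nat) \<Rightarrow> 'a" where
  "join z = Sup_fin ((\<lambda>i. \<rho> i (z i)) ` {1..n})"

lemma join_le_iff: "join z \<le> b \<longleftrightarrow> (\<forall>i\<in>{1..n}. \<rho> i (z i) \<le> b)"
  unfolding join_def using n_pos by (subst Sup_fin.bounded_iff) auto

lemma join_eqI: "(\<And>b. x \<le> b \<longleftrightarrow> (\<forall>i\<in>{1..n}. \<rho> i (z i) \<le> b)) \<Longrightarrow> join z = x"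
  using join_le_iff by (metis order.antisym order.refl)

lemma join_cong: "(\<And>i. i \<in> {1..n} \<Longrightarrow> z i = w i) \<Longrightarrow> join z = join w"
  unfolding join_def by (metis (mono_tags, lifting) image_cong)

lemma one_in: "1 \<in> {1..n}" using n_pos by simp

lemma join_0: "join (\<lambda>_. 0) = a"
  using rays one_in by (intro join_eqI) (auto simp: ray_def)

lemma join_max: "join (\<lambda>i. max (z i) (w i)) = sup (join z) (join w)"
proof (rule join_eqI)
  fix b :: 'a
  have "\<rho> i (max (z i) (w i)) \<le> b \<longleftrightarrow> \<rho> i (z i) \<le> b \<and> \<rho> i (w i) \<le> b" if "i \<in> {1..n}" for i
    using ray_mono[OF rays[OF that], of "z i" "w i"] ray_mono[OF rays[OF that], of "w i" "z i"]
    by (auto simp: max_def intro: order_trans)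
  then show "sup (join z) (join w) \<le> b \<longleftrightarrow> (\<forall>i\<in>{1..n}. \<rho> i (max (z i) (w i)) \<le> b)"
    by (auto simp: join_le_iff)
qed

text \<open>
  By \<open>ray_asc\<close>, \<open>asc (\<rho> i m)\<close> is the join of the next element of the ray and \<open>asc a\<close>; the latter is
  absorbed because the first steps of all rays already join to an element above \<open>asc a\<close>.
\<close>

lemma join_Suc: "join (\<lambda>i. Suc (z i)) = asc (join z)"
proof (rule join_eqI)
  fix b :: 'a
  obtain b' where b': "b = asc b'" by (rule asc_surjE[of b])
  have "asc (join z) \<le> b \<longleftrightarrow> (\<forall>i\<in>{1..n}. asc (\<rho> i (z i)) \<le> b)"
    unfolding b' by (simp add: join_le_iff)
  also have "\<dots> \<longleftrightarrow> (\<forall>i\<in>{1..n}. \<rho> i (Suc (z i)) \<le> b \<and> asc a \<le> b)"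
    using ray_asc[OF rays] by (metis le_sup_iff)
  also have "\<dots> \<longleftrightarrow> (\<forall>i\<in>{1..n}. \<rho> i (Suc (z i)) \<le> b)"
  proof -
    have "asc a \<le> b" if "\<forall>i\<in>{1..n}. \<rho> i (Suc (z i)) \<le> b"
    proof (rule indep)
      fix i assume i: "i \<in> {1..n}"
      then show "\<rho> i 1 \<le> b"
        using that ray_mono[OF rays[OF i], of 1 "Suc (z i)"] by (auto intro: order_trans)
    qed
    then show ?thesis by blast
  qed
  finally show "asc (join z) \<le> b \<longleftrightarrow> (\<forall>i\<in>{1..n}. \<rho> i (Suc (z i)) \<le> b)" .
qed

text \<open>
  The new join is the join of the old one with a cover of an element below it.
\<close>

lemma height_join_step:
  assumes i: "i \<in> {1..n}" shows "height (join (z(i := Suc (z i)))) \<le> height (join z) + 1"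
proof -
  define r where "r = \<rho> i (Suc (z i))"
  have cov: "covers r (\<rho> i (z i))" using rays[OF i] by (auto simp: ray_def r_def)
  have "join (z(i := Suc (z i))) = sup (join z) r"
  proof (rule join_eqI)
    fix b show "sup (join z) r \<le> b \<longleftrightarrow> (\<forall>j\<in>{1..n}. \<rho> j ((z(i := Suc (z i))) j) \<le> b)"
      using i covers_le[OF cov] by (auto simp: join_le_iff r_def intro: order_trans)
  qed
  moreover have "\<rho> i (z i) \<le> inf (join z) r"
    using i covers_le[OF cov] join_le_iff[of z "join z"] by auto
  ultimately show ?thesis
    using height_sup_inf[of "join z" r] height_covers[OF cov] height_mono[of "\<rho> i (z i)" "inf (join z) r"] by simp
qed

lemma height_join_add: "height (join (\<lambda>i. z i + w i)) \<le> height (join z) + int (\<Sum>i=1..n. w i)"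
proof (induction "\<Sum>i=1..n. w i" arbitrary: w)
  case 0
  then have "join (\<lambda>i. z i + w i) = join z" by (intro join_cong) auto
  then have "height (join (\<lambda>i. z i + w i)) \<le> height (join z)" by simp
  then show ?case using of_nat_0_le_iff[of "\<Sum>i=1..n. w i"] by linarith
next
  case (Suc k)
  then obtain i where i: "i \<in> {1..n}" "w i \<noteq> 0" by (metis sum.neutral nat.distinct(1))
  define v where "v = w(i := w i - 1)"
  have w: "w = v(i := Suc (v i))" using i by (auto simp: v_def)
  have sum: "(\<Sum>j=1..n. w j) = Suc (\<Sum>j=1..n. v j)"
    using i sum.remove[of "{1..n}" i w] sum.remove[of "{1..n}" i v] by (simp add: v_def)
  have "(\<lambda>j. z j + w j) = (\<lambda>j. z j + v j)(i := Suc (z i + v i))" using w by (auto simp: fun_eq_iff)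
  then have "height (join (\<lambda>j. z j + w j)) \<le> height (join (\<lambda>j. z j + v j)) + 1"
    using height_join_step[OF i(1), of "\<lambda>j. z j + v j"] by simp
  moreover have "height (join (\<lambda>j. z j + v j)) \<le> height (join z) + int (\<Sum>i=1..n. v i)"
    using Suc.hyps sum by simp
  ultimately show ?case using sum by simp
qed

text \<open>
  The upper bound counts steps from \<open>a\<close>. The same count from \<open>z\<close> up to a constant vector \<open>(m, \<dots>, m)\<close>,
  whose height is known to be \<open>height a + n * m\<close>, gives the lower bound.
\<close>

lemma height_join: "height (join z) = height a + int (\<Sum>i=1..n. z i)"
proof (rule order.antisym)
  show "height (join z) \<le> height a + int (\<Sum>i=1..n. z i)"
    using height_join_add[of "\<lambda>_. 0" z] by (simp add: join_0)
next
  have const: "height (join (\<lambda>_. m)) = height a + int n * int m" for m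
  proof (induction m)
    case (Suc m)
    then show ?case using join_Suc[of "\<lambda>_. m"] height_asc by (simp add: algebra_simps)
  qed (simp add: join_0)
  define m where "m = (\<Sum>i=1..n. z i)"
  have le: "z i \<le> m" if "i \<in> {1..n}" for i unfolding m_def using that by (intro member_le_sum) auto
  then have "join (\<lambda>i. z i + (m - z i)) = join (\<lambda>_. m)" by (intro join_cong) simp
  then have "height a + int n * int m \<le> height (join z) + int (\<Sum>i=1..n. m - z i)"
    using height_join_add[of z "\<lambda>i. m - z i"] const by simp
  moreover have "(\<Sum>i=1..n. m - z i) + (\<Sum>i=1..n. z i) = n * m"
  proof -
    have "(\<Sum>i=1..n. m - z i) + (\<Sum>i=1..n. z i) = (\<Sum>i=1..n. (m - z i) + z i)" by (simp only: sum.distrib)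
    also have "\<dots> = (\<Sum>i=1..n. m)" using le by (intro sum.cong) auto
    finally show ?thesis by simp
  qed
  then have "int (\<Sum>i=1..n. m - z i) + int (\<Sum>i=1..n. z i) = int n * int m"
    by (metis of_nat_add of_nat_mult)
  ultimately show "height a + int (\<Sum>i=1..n. z i) \<le> height (join z)" by linarith
qed

text \<open>
  The inequality is clear and both sides have the same height: the height is additive on both sides
  of \<open>sup\<close> and \<open>inf\<close>, and sums of coordinates are additive for \<open>max\<close> and \<open>min\<close>.
\<close>

lemma join_min: "join (\<lambda>i. min (z i) (w i)) = inf (join z) (join w)"
proof (rule height_le_eq)
  have "\<rho> i (min (z i) (w i)) \<le> \<rho> i (z i) \<and> \<rho> i (min (z i) (w i)) \<le> \<rho> i (w i)" if "i \<in> {1..n}" for i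
    using ray_mono[OF rays[OF that]] by auto
  then have "join (\<lambda>i. min (z i) (w i)) \<le> join z \<and> join (\<lambda>i. min (z i) (w i)) \<le> join w"
    using join_le_iff[of z "join z"] join_le_iff[of w "join w"]
    unfolding join_le_iff[of "\<lambda>i. min (z i) (w i)"] by (meson order.refl order_trans)
  then show "join (\<lambda>i. min (z i) (w i)) \<le> inf (join z) (join w)" by simp
  have "(\<Sum>i=1..n. max (z i) (w i)) + (\<Sum>i=1..n. min (z i) (w i)) = (\<Sum>i=1..n. z i) + (\<Sum>i=1..n. w i)"
    unfolding sum.distrib[symmetric] by (intro sum.cong) auto
  then have "int (\<Sum>i=1..n. max (z i) (w i)) + int (\<Sum>i=1..n. min (z i) (w i))
     = int (\<Sum>i=1..n. z i) + int (\<Sum>i=1..n. w i)" by (metis of_nat_add)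
  then show "height (inf (join z) (join w)) \<le> height (join (\<lambda>i. min (z i) (w i)))"
    using height_sup_inf[of "join z" "join w"] unfolding join_max[symmetric] height_join by linarith
qed

text \<open>
  The joins describe the part of the skeleton above \<open>a\<close>. Any vector is shifted there by a multiple
  of the all-one vector, and the shift is undone by a power of \<open>asc\<close>; every
  shift to nonnegative coordinates gives the same value, by the next lemma.
\<close>

definition frame :: "(nat \<Rightarrow> int) \<Rightarrow> 'a" where
  "frame z = asc_pow (- (\<Sum>i=1..n. \<bar>z i\<bar>)) (join (\<lambda>i. nat (z i + (\<Sum>i=1..n. \<bar>z i\<bar>))))"

lemma frame_eq:
  assumes m: "\<And>i. i \<in> {1..n} \<Longrightarrow> 0 \<le> z i + m"
  shows "frame z = asc_pow (- m) (join (\<lambda>i. nat (z i + m)))"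
proof -
  define \<Psi> where "\<Psi> m = asc_pow (- m) (join (\<lambda>i. nat (z i + m)))" for m
  have shift: "\<Psi> (m + int k) = \<Psi> m" if "\<And>i. i \<in> {1..n} \<Longrightarrow> 0 \<le> z i + m" for m k
  proof (induction k)
    case (Suc k)
    have "join (\<lambda>i. nat (z i + (m + int (Suc k)))) = join (\<lambda>i. Suc (nat (z i + (m + int k))))"
      using that by (intro join_cong) (fastforce simp: nat_add_distrib)
    also have "\<dots> = asc_pow 1 (join (\<lambda>i. nat (z i + (m + int k))))"
      by (simp only: join_Suc asc_pow_1)
    finally have "\<Psi> (m + int (Suc k)) = \<Psi> (m + int k)"
      unfolding \<Psi>_def by (simp only: asc_pow_add[symmetric]) (simp add: algebra_simps)
    then show ?case using Suc by simp
  qed simp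
  define s where "s = (\<Sum>i=1..n. \<bar>z i\<bar>)"
  have s: "0 \<le> z i + s" if "i \<in> {1..n}" for i
  proof -
    have "\<bar>z i\<bar> \<le> s" unfolding s_def using that by (intro member_le_sum) auto
    then show ?thesis by simp
  qed
  have "\<Psi> s = \<Psi> m"
  proof (cases "s \<le> m")
    case True then show ?thesis using shift[of s "nat (m - s)", OF s] by simp
  next
    case False then show ?thesis using shift[of m "nat (s - m)", OF m] by simp
  qed
  then show ?thesis by (simp add: \<Psi>_def frame_def s_def)
qed

lemma common_shift: "\<exists>m. \<forall>i\<in>{1..n}. 0 \<le> z i + m \<and> 0 \<le> w i + (m :: int)"
proof -
  define m where "m = (\<Sum>i=1..n. \<bar>z i\<bar> + \<bar>w i\<bar>)"
  have "\<bar>z i\<bar> + \<bar>w i\<bar> \<le> m" if "i \<in> {1..n}" for i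
    unfolding m_def using that by (intro member_le_sum) auto
  then show ?thesis by (intro exI[of _ m]) force
qed

lemma frame_nonneg: "(\<And>i. i \<in> {1..n} \<Longrightarrow> 0 \<le> z i) \<Longrightarrow> frame z = join (\<lambda>i. nat (z i))"
  using frame_eq[of z 0] by simp

lemma skeleton_frame: "skeleton frame"
  unfolding skeleton_def
proof (intro conjI allI impI)
  fix z w :: "nat \<Rightarrow> int"
  obtain m where m: "\<And>i. i \<in> {1..n} \<Longrightarrow> 0 \<le> z i + m" "\<And>i. i \<in> {1..n} \<Longrightarrow> 0 \<le> w i + m"
    using common_shift[of z w] by blast
  have eqs: "frame z = asc_pow (- m) (join (\<lambda>i. nat (z i + m)))"
    "frame w = asc_pow (- m) (join (\<lambda>i. nat (w i + m)))"
    by (intro frame_eq m; assumption)+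
  {
    assume "\<forall>i\<in>{1..n}. z i = w i"
    then have "join (\<lambda>i. nat (z i + m)) = join (\<lambda>i. nat (w i + m))" by (intro join_cong) simp
    then have "frame z = frame w" unfolding eqs by (rule arg_cong)
  }
  then show "\<forall>i\<in>{1..n}. z i = w i \<Longrightarrow> frame z = frame w" by blast
  have "frame (\<lambda>i. max (z i) (w i)) = asc_pow (- m) (join (\<lambda>i. nat (max (z i) (w i) + m)))"
    using m by (intro frame_eq) (auto simp: max_def)
  also have "join (\<lambda>i. nat (max (z i) (w i) + m)) = join (\<lambda>i. max (nat (z i + m)) (nat (w i + m)))"
    by (intro join_cong) (auto simp: max_def)
  finally show "frame (\<lambda>i. max (z i) (w i)) = sup (frame z) (frame w)"
    by (simp add: join_max asc_pow_sup eqs)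
  have "frame (\<lambda>i. min (z i) (w i)) = asc_pow (- m) (join (\<lambda>i. nat (min (z i) (w i) + m)))"
    using m by (intro frame_eq) (auto simp: min_def)
  also have "join (\<lambda>i. nat (min (z i) (w i) + m)) = join (\<lambda>i. min (nat (z i + m)) (nat (w i + m)))"
    by (intro join_cong) (auto simp: min_def)
  finally show "frame (\<lambda>i. min (z i) (w i)) = inf (frame z) (frame w)"
    by (simp add: join_min asc_pow_inf eqs)
  have "frame (\<lambda>i. z i + 1) = asc_pow (- m) (join (\<lambda>i. nat (z i + 1 + m)))"
    using m(1) by (intro frame_eq) fastforce
  also have "join (\<lambda>i. nat (z i + 1 + m)) = join (\<lambda>i. Suc (nat (z i + m)))"
    using m(1) by (intro join_cong) (fastforce simp: nat_add_distrib)
  finally show "frame (\<lambda>i. z i + 1) = asc (frame z)"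
    by (simp add: join_Suc asc_pow_commute eqs)
  have "(\<Sum>i=1..n. int (nat (z i + m))) = (\<Sum>i=1..n. z i + m)" using m(1) by (intro sum.cong) auto
  then have "height (frame z) = height a + (\<Sum>i=1..n. z i)"
    unfolding eqs height_asc_pow height_join by (simp add: sum.distrib mult.commute)
  moreover have "frame (\<lambda>_. 0) = a" using frame_nonneg[of "\<lambda>_. 0"] join_0 by simp
  ultimately show "height (frame z) = height (frame (\<lambda>_. 0)) + (\<Sum>i=1..n. z i)" by simp
qed

end

context uniform_modular
begin

lemma skeleton_of_rays:
  assumes "\<And>i. i \<in> {1..n} \<Longrightarrow> ray a (\<rho> i)"
    and "\<And>b. (\<And>i. i \<in> {1..n} \<Longrightarrow> \<rho> i 1 \<le> b) \<Longrightarrow> asc a \<le> b"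
  shows "\<exists>\<phi>. skeleton \<phi> \<and>
    (\<forall>z b. (\<forall>i\<in>{1..n}. 0 \<le> z i) \<longrightarrow> (\<phi> z \<le> b \<longleftrightarrow> (\<forall>i\<in>{1..n}. \<rho> i (nat (z i)) \<le> b)))"
proof -
  interpret ray_frame ty n a \<rho> by unfold_locales (use assms in blast)+
  show ?thesis using skeleton_frame frame_nonneg join_le_iff by (intro exI[of _ frame]) auto
qed

end


section \<open>Order and translation in a skeleton\<close>

abbreviation indic :: "nat set \<Rightarrow> nat \<Rightarrow> int" where
  "indic T \<equiv> \<lambda>i. of_bool (i \<in> T)"

context uniform_modular
begin

lemma skeleton_cong: "skeleton \<phi> \<Longrightarrow> (\<And>i. i \<in> {1..n} \<Longrightarrow> z i = w i) \<Longrightarrow> \<phi> z = \<phi> w"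
  and skeleton_max: "skeleton \<phi> \<Longrightarrow> \<phi> (\<lambda>i. max (z i) (w i)) = sup (\<phi> z) (\<phi> w)"
  and skeleton_min: "skeleton \<phi> \<Longrightarrow> \<phi> (\<lambda>i. min (z i) (w i)) = inf (\<phi> z) (\<phi> w)"
  and skeleton_asc: "skeleton \<phi> \<Longrightarrow> \<phi> (\<lambda>i. z i + 1) = asc (\<phi> z)"
  and skeleton_height: "skeleton \<phi> \<Longrightarrow> height (\<phi> z) = height (\<phi> (\<lambda>_. 0)) + (\<Sum>i=1..n. z i)"
  unfolding skeleton_def by blast+

text \<open>
  If \<open>\<phi> z \<le> \<phi> w\<close>, then \<open>w\<close> and the maximum of \<open>z\<close> and \<open>w\<close> have images of the same height, so the same
  coordinate sum, so they agree.
\<close>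

lemma skeleton_le_iff: assumes "skeleton \<phi>" shows "\<phi> z \<le> \<phi> w \<longleftrightarrow> (\<forall>i\<in>{1..n}. z i \<le> w i)"
proof
  assume "\<phi> z \<le> \<phi> w"
  then have "\<phi> (\<lambda>i. max (z i) (w i)) = \<phi> w" by (simp add: skeleton_max[OF assms] sup.absorb2)
  then have eq: "(\<Sum>i=1..n. w i) = (\<Sum>i=1..n. max (z i) (w i))"
    using skeleton_height[OF assms, of w] skeleton_height[OF assms, of "\<lambda>i. max (z i) (w i)"] by simp
  show "\<forall>i\<in>{1..n}. z i \<le> w i"
  proof
    fix i assume "i \<in> {1..n}"
    then have "w i = max (z i) (w i)" by (intro sum_mono_inv[OF eq]) auto
    then show "z i \<le> w i" by simp
  qed
next
  assume "\<forall>i\<in>{1..n}. z i \<le> w i"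
  then have "\<phi> (\<lambda>i. max (z i) (w i)) = \<phi> w" by (intro skeleton_cong[OF assms]) auto
  then show "\<phi> z \<le> \<phi> w" by (metis skeleton_max[OF assms] sup.cobounded1)
qed

lemma skeleton_eq_iff: "skeleton \<phi> \<Longrightarrow> \<phi> z = \<phi> w \<longleftrightarrow> (\<forall>i\<in>{1..n}. z i = w i)"
  using skeleton_le_iff[of \<phi> z w] skeleton_le_iff[of \<phi> w z] by (auto intro: order.antisym)

lemma skeleton_shift: assumes "skeleton \<phi>" shows "\<phi> (\<lambda>i. z i + k) = asc_pow k (\<phi> z)"
proof (induction k rule: int_induct[where k = 0])
  case (step1 k)
  then show ?case using skeleton_asc[OF assms, of "\<lambda>i. z i + k"] asc_pow_Suc[of k]
    by (simp add: add.assoc)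
next
  case (step2 k)
  have "asc (\<phi> (\<lambda>i. z i + (k - 1))) = asc (asc_pow (k - 1) (\<phi> z))"
    using step2 skeleton_asc[OF assms, of "\<lambda>i. z i + (k - 1)"] asc_pow_Suc[of "k - 1" "\<phi> z"] by simp
  then show ?case by simp
qed simp

lemma skeleton_range_pow: assumes "skeleton \<phi>" shows "asc_pow k x \<in> range \<phi> \<longleftrightarrow> x \<in> range \<phi>"
proof -
  have *: "asc_pow k x \<in> range \<phi>" if x: "x \<in> range \<phi>" for x k
  proof -
    obtain z where "x = \<phi> z" using x by blast
    then have "asc_pow k x = \<phi> (\<lambda>i. z i + k)" by (simp add: skeleton_shift[OF assms])
    then show ?thesis by blast
  qed
  show ?thesis using *[of x k] *[of "asc_pow k x" "- k"] by auto
qed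

lemma skeleton_reparam:
  assumes \<phi>: "skeleton \<phi>" and \<sigma>: "\<sigma> permutes {1..n}"
  shows "skeleton (\<lambda>w. \<phi> (\<lambda>i. u i + w (\<sigma> i)))" (is "skeleton ?\<psi>")
    and "range (\<lambda>w. \<phi> (\<lambda>i. u i + w (\<sigma> i))) = range \<phi>"
proof -
  have in\<sigma>: "\<sigma> i \<in> {1..n}" if "i \<in> {1..n}" for i using that permutes_in_image[OF \<sigma>] by blast
  show "skeleton ?\<psi>"
    unfolding skeleton_def
  proof (intro conjI allI impI)
    fix z w :: "nat \<Rightarrow> int"
    show "\<forall>i\<in>{1..n}. z i = w i \<Longrightarrow> ?\<psi> z = ?\<psi> w"
      using in\<sigma> by (intro skeleton_cong[OF \<phi>]) simp
    show "?\<psi> (\<lambda>i. max (z i) (w i)) = sup (?\<psi> z) (?\<psi> w)"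
      by (simp flip: skeleton_max[OF \<phi>] add: max_add_distrib_right)
    show "?\<psi> (\<lambda>i. min (z i) (w i)) = inf (?\<psi> z) (?\<psi> w)"
      by (simp flip: skeleton_min[OF \<phi>] add: min_add_distrib_right)
    show "?\<psi> (\<lambda>i. z i + 1) = asc (?\<psi> z)"
      by (simp flip: skeleton_asc[OF \<phi>] add: algebra_simps)
    have "(\<Sum>i=1..n. z (\<sigma> i)) = (\<Sum>i=1..n. z i)"
      using sum.permute[OF \<sigma>, of z] by simp
    then show "height (?\<psi> z) = height (?\<psi> (\<lambda>_. 0)) + (\<Sum>i=1..n. z i)"
      using skeleton_height[OF \<phi>, of "\<lambda>i. u i + z (\<sigma> i)"] skeleton_height[OF \<phi>, of u] by (simp add: sum.distrib)
  qed
  show "range ?\<psi> = range \<phi>"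
  proof (intro equalityI subsetI)
    fix x assume "x \<in> range \<phi>"
    then obtain z where "x = \<phi> z" by blast
    then show "x \<in> range ?\<psi>"
      by (intro image_eqI[where x = "\<lambda>j. z (inv \<sigma> j) - u (inv \<sigma> j)"])
        (simp_all add: permutes_inverses(2)[OF \<sigma>])
  qed auto
qed

lemma skeleton_step:
  assumes "skeleton \<phi>" "i \<in> {1..n}" shows "covers (\<phi> (z(i := z i + 1))) (\<phi> z)"
proof (rule height_coversI)
  show "\<phi> z \<le> \<phi> (z(i := z i + 1))" by (simp add: skeleton_le_iff[OF assms(1)])
  have "(\<Sum>j=1..n. (z(i := z i + 1)) j) = (\<Sum>j=1..n. z j) + 1"
    using assms(2) by (simp add: sum.remove)
  then show "height (\<phi> (z(i := z i + 1))) = height (\<phi> z) + 1"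
    using skeleton_height[OF assms(1), of z] skeleton_height[OF assms(1), of "z(i := z i + 1)"] by simp
qed

lemma skeleton_ray:
  assumes "skeleton \<phi>" "k \<in> {1..n}" shows "ray (\<phi> (\<lambda>_. 0)) (\<lambda>m. \<phi> ((\<lambda>_. 0)(k := int m)))"
  unfolding ray_def
proof (intro conjI allI)
  have "(\<lambda>_. 0)(k := int 0) = (\<lambda>_. 0)" by auto
  then show "\<phi> ((\<lambda>_. 0)(k := int 0)) = \<phi> (\<lambda>_. 0)" by simp
  fix m
  show "covers (\<phi> ((\<lambda>_. 0)(k := int (Suc m)))) (\<phi> ((\<lambda>_. 0)(k := int m)))"
    using skeleton_step[OF assms, of "(\<lambda>_. 0)(k := int m)"] by (simp add: add.commute)
  show "\<not> \<phi> ((\<lambda>_. 0)(k := int (Suc (Suc m)))) \<le> asc (\<phi> ((\<lambda>_. 0)(k := int m)))"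
    unfolding skeleton_asc[OF assms(1), symmetric] skeleton_le_iff[OF assms(1)] using assms(2) by force
qed

lemma skeleton_indic_le:
  assumes \<phi>: "skeleton \<phi>" and "finite S" "\<phi> (\<lambda>_. 0) \<le> b" "\<And>k. k \<in> S \<Longrightarrow> \<phi> ((\<lambda>_. 0)(k := 1)) \<le> b"
  shows "\<phi> (indic S) \<le> b"
  using assms(2-)
proof (induction S)
  case (insert k S)
  have "indic (insert k S) = (\<lambda>i. max (indic S i) (((\<lambda>_. 0)(k := 1)) i))" by auto
  then have eq: "\<phi> (indic (insert k S)) = sup (\<phi> (indic S)) (\<phi> ((\<lambda>_. 0)(k := 1)))"
    using skeleton_max[OF \<phi>] by metis
  show ?case unfolding eq
  proof (rule le_supI)
    show "\<phi> (indic S) \<le> b" using insert.prems by (intro insert.IH) blast+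
    show "\<phi> ((\<lambda>_. 0)(k := 1)) \<le> b" by (rule insert.prems(2)) simp
  qed
qed simp


section \<open>Exchanging one ray of a skeleton\<close>

text \<open>
  In the model, \<open>c = a + t\<^sup>-\<^sup>1 O w\<close> with \<open>w = \<Sum>\<^bsub>j\<in>T\<^esub> \<lambda>\<^sub>j v\<^sub>j\<close> and units \<open>\<lambda>\<^sub>j\<close>, and any one of
  the \<open>v\<^sub>i\<close>, \<open>i \<in> T\<close>, can be replaced by \<open>w\<close>. The support \<open>T\<close> is recovered as a smallest set with
  \<open>c \<le> \<phi> (indic T)\<close>. The new ray is confined to the cube diagonal, \<open>r m \<le> \<phi> (m * indic T)\<close>.
  Therefore a point \<open>z\<close> whose \<open>i\<close>-th coordinate is minimal among those in \<open>T\<close> dominates the part of the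
  new ray that contributes to it, and the new skeleton cannot exceed \<open>\<phi>\<close> there; the heights agree, so
  the values do.
\<close>

lemma skeleton_exchange_0:
  assumes \<phi>: "skeleton \<phi>" and c: "covers c (\<phi> (\<lambda>_. 0))"
  shows "\<exists>T. T \<subseteq> {1..n} \<and> T \<noteq> {} \<and> (\<forall>w. c \<le> \<phi> w \<longrightarrow> (\<forall>j\<in>T. 0 < w j)) \<and>
    (\<forall>i\<in>T. \<exists>\<phi>'. skeleton \<phi>' \<and> c \<in> range \<phi>' \<and> (\<forall>z. (\<forall>j\<in>T. z i \<le> z j) \<longrightarrow> \<phi>' z = \<phi> z))"
proof -
  define a where "a = \<phi> (\<lambda>_. 0)"
  have ac: "covers c a" "a \<le> c" "a \<noteq> c" using c covers_less[OF c] by (auto simp: a_def)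
  define P where "P T \<longleftrightarrow> T \<subseteq> {1..n} \<and> c \<le> \<phi> (indic T)" for T
  have asc_a: "asc a = \<phi> (indic {1..n})"
    unfolding a_def skeleton_asc[OF \<phi>, symmetric] by (intro skeleton_cong[OF \<phi>]) simp
  have "P {1..n}" using covers_le_asc[OF ac(1)] asc_a by (simp add: P_def)
  then obtain T where T: "P T" and min: "\<And>S. P S \<Longrightarrow> card T \<le> card S"
    using ex_has_least_nat[of P _ card] by blast
  have fin: "finite T" and TI: "T \<subseteq> {1..n}" and cT: "c \<le> \<phi> (indic T)"
    using T finite_subset by (auto simp: P_def)
  have pos: "\<forall>j\<in>T. 0 < w j" if w: "c \<le> \<phi> w" for w
  proof -
    define S where "S = {j \<in> T. 0 < w j}"
    have "\<forall>i\<in>{1..n}. 0 \<le> w i"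
      using order_trans[OF ac(2) w] by (simp add: a_def skeleton_le_iff[OF \<phi>])
    then have "\<phi> (\<lambda>i. min (w i) (indic T i)) = \<phi> (indic S)"
      by (intro skeleton_cong[OF \<phi>]) (fastforce simp: S_def)
    moreover have "c \<le> \<phi> (\<lambda>i. min (w i) (indic T i))" using w cT by (simp add: skeleton_min[OF \<phi>])
    ultimately have "c \<le> \<phi> (indic S)" by metis
    then have "P S" using TI by (auto simp: P_def S_def)
    then have "S = T" using min fin by (intro card_seteq) (auto simp: S_def)
    then show ?thesis by (auto simp: S_def)
  qed
  have "T \<noteq> {}"
  proof
    assume "T = {}"
    then have "c \<le> a" using cT by (simp add: a_def)
    then show False using ac by simp
  qed
  moreover have "\<exists>\<phi>'. skeleton \<phi>' \<and> c \<in> range \<phi>' \<and> (\<forall>z. (\<forall>j\<in>T. z i \<le> z j) \<longrightarrow> \<phi>' z = \<phi> z)"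
    if i: "i \<in> T" for i
  proof -
    have iI: "i \<in> {1..n}" using i TI by auto
    define p where "p = \<phi> (indic (T - {i}))"
    have "indic T = (indic (T - {i}))(i := indic (T - {i}) i + 1)" using i by auto
    then have covp: "covers (\<phi> (indic T)) p" using skeleton_step[OF \<phi> iI] unfolding p_def by metis
    have "\<not> c \<le> p" using pos[of "indic (T - {i})"] i by (auto simp: p_def)
    then have sup_pc: "sup p c = \<phi> (indic T)"
      using coversD[OF covp, of "sup p c"] covers_le[OF covp] cT by (metis le_sup_iff sup.cobounded1 sup.cobounded2)
    \<comment> \<open>The bounds that confine the new ray; they start at the first step, where the bound is
      \<open>\<phi> (indic T)\<close>.\<close>
    define G where "G m = \<phi> (\<lambda>j. int (Suc m) * indic T j)" for m
    have "\<exists>\<rho>. ray a \<rho> \<and> \<rho> 1 = c \<and> (\<forall>m. \<rho> (Suc m) \<le> G m)"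
    proof (rule ray_exists[OF ac(1)])
      show "c \<le> G 0" using cT by (simp add: G_def)
      show "G m \<le> G (Suc m)" for m by (simp add: G_def skeleton_le_iff[OF \<phi>])
      show "asc (G m) \<le> sup (G (Suc m)) (asc a)" for m
        unfolding G_def a_def skeleton_asc[OF \<phi>, symmetric] skeleton_max[OF \<phi>, symmetric] skeleton_le_iff[OF \<phi>]
        by simp
    qed
    then obtain r where r: "ray a r" "r 1 = c" "\<And>m. r (Suc m) \<le> G m" by blast
    define \<rho> where "\<rho> k = (if k = i then r else (\<lambda>m. \<phi> ((\<lambda>_. 0)(k := int m))))" for k
    have rays: "ray a (\<rho> k)" if "k \<in> {1..n}" for k
      using r skeleton_ray[OF \<phi> that] by (simp add: \<rho>_def a_def)
    have r0: "\<rho> k 0 = a" if "k \<in> {1..n}" for k using rays[OF that] by (simp add: ray_def)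
    have "asc a \<le> b" if b: "\<And>k. k \<in> {1..n} \<Longrightarrow> \<rho> k 1 \<le> b" for b
    proof -
      have cb: "c \<le> b" using b[OF iI] r by (simp add: \<rho>_def)
      then have ab: "\<phi> (\<lambda>_. 0) \<le> b" using ac unfolding a_def by (blast intro: order_trans)
      have other: "\<phi> ((\<lambda>_. 0)(k := 1)) \<le> b" if "k \<in> {1..n}" "k \<noteq> i" for k
        using b[OF that(1)] that(2) by (simp add: \<rho>_def)
      have "p \<le> b" unfolding p_def
        using fin ab other TI by (intro skeleton_indic_le[OF \<phi>]) auto
      then have "\<phi> (indic T) \<le> b" using cb unfolding sup_pc[symmetric] by simp
      moreover have "\<phi> ((\<lambda>_. 0)(i := 1)) \<le> \<phi> (indic T)" using i by (simp add: skeleton_le_iff[OF \<phi>])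
      ultimately have "\<phi> ((\<lambda>_. 0)(k := 1)) \<le> b" if "k \<in> {1..n}" for k
        using other[OF that] by (cases "k = i") (auto intro: order_trans)
      then show ?thesis unfolding asc_a using ab by (intro skeleton_indic_le[OF \<phi>]) auto
    qed
    with rays have "\<exists>\<psi>. skeleton \<psi> \<and> (\<forall>z b. (\<forall>k\<in>{1..n}. 0 \<le> z k) \<longrightarrow>
        (\<psi> z \<le> b \<longleftrightarrow> (\<forall>k\<in>{1..n}. \<rho> k (nat (z k)) \<le> b)))"
      by (rule skeleton_of_rays)
    then obtain \<psi> where \<psi>: "skeleton \<psi>"
      and \<psi>_all: "\<forall>z b. (\<forall>k\<in>{1..n}. 0 \<le> z k) \<longrightarrow> (\<psi> z \<le> b \<longleftrightarrow> (\<forall>k\<in>{1..n}. \<rho> k (nat (z k)) \<le> b))"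
      by blast
    have \<psi>_le: "\<psi> z \<le> b \<longleftrightarrow> (\<forall>k\<in>{1..n}. \<rho> k (nat (z k)) \<le> b)"
      if "\<And>k. k \<in> {1..n} \<Longrightarrow> 0 \<le> z k" for z b using \<psi>_all that by blast
    have "\<psi> (\<lambda>_. 0) \<le> b \<longleftrightarrow> a \<le> b" for b using \<psi>_le[of "\<lambda>_. 0" b] r0 iI by auto
    then have \<psi>0: "\<psi> (\<lambda>_. 0) = a" by (metis order.antisym order.refl)
    have "\<psi> ((\<lambda>_. 0)(i := 1)) \<le> b \<longleftrightarrow> c \<le> b" for b
    proof -
      have "\<rho> k (nat (((\<lambda>_. 0)(i := 1)) k)) = (if k = i then c else a)" if "k \<in> {1..n}" for k
        using r0[OF that] r(2) by (cases "k = i") (simp_all add: \<rho>_def)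
      then have "\<psi> ((\<lambda>_. 0)(i := 1)) \<le> b \<longleftrightarrow> (\<forall>k\<in>{1..n}. (if k = i then c else a) \<le> b)"
        by (subst \<psi>_le) simp_all
      then show ?thesis using iI order_trans[OF ac(2)] by auto
    qed
    then have "\<psi> ((\<lambda>_. 0)(i := 1)) = c" by (metis order.antisym order.refl)
    then have "c \<in> range \<psi>" by blast
    moreover have nonneg: "\<psi> z = \<phi> z"
      if z: "\<forall>j\<in>T. z i \<le> z j" and z0: "\<And>k. k \<in> {1..n} \<Longrightarrow> 0 \<le> z k" for z
    proof (rule height_le_eq)
      have "\<rho> k (nat (z k)) \<le> \<phi> z" if k: "k \<in> {1..n}" for k
      proof (cases "k = i")
        case False
        then show ?thesis using z0 k by (simp add: \<rho>_def skeleton_le_iff[OF \<phi>])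
      next
        case True
        show ?thesis
        proof (cases "nat (z i)")
          case 0
          then show ?thesis using r0[OF k] True z0 by (simp add: a_def skeleton_le_iff[OF \<phi>])
        next
          case (Suc m)
          have "G m \<le> \<phi> z" unfolding G_def skeleton_le_iff[OF \<phi>]
          proof
            fix j assume j: "j \<in> {1..n}"
            show "int (Suc m) * indic T j \<le> z j" using z z0[OF j] Suc by (cases "j \<in> T") auto
          qed
          then show ?thesis using r(3)[of m] True Suc by (simp add: \<rho>_def order_trans)
        qed
      qed
      then show "\<psi> z \<le> \<phi> z" using \<psi>_le z0 by blast
      show "height (\<phi> z) \<le> height (\<psi> z)"
        using skeleton_height[OF \<phi>, of z] skeleton_height[OF \<psi>, of z] \<psi>0 by (simp add: a_def)
    qed
    have "\<psi> z = \<phi> z" if z: "\<forall>j\<in>T. z i \<le> z j" for z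
    proof -
      \<comment> \<open>A shift by \<open>k\<close> makes all coordinates nonnegative and commutes with both skeletons.\<close>
      define k where "k = (\<Sum>j=1..n. \<bar>z j\<bar>)"
      have "\<bar>z j\<bar> \<le> k" if "j \<in> {1..n}" for j unfolding k_def using that by (intro member_le_sum) auto
      then have "\<psi> (\<lambda>j. z j + k) = \<phi> (\<lambda>j. z j + k)" using z by (intro nonneg) force+
      then show ?thesis by (simp add: skeleton_shift[OF \<phi>] skeleton_shift[OF \<psi>])
    qed
    ultimately show ?thesis using \<psi> by blast
  qed
  ultimately show ?thesis using TI pos by blast
qed

lemma skeleton_exchange:
  assumes \<phi>: "skeleton \<phi>" and c: "covers c (\<phi> u)"
  shows "\<exists>T. T \<subseteq> {1..n} \<and> T \<noteq> {} \<and> (\<forall>w. c \<le> \<phi> w \<longrightarrow> (\<forall>j\<in>T. u j < w j)) \<and>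
    (\<forall>i\<in>T. \<exists>\<phi>'. skeleton \<phi>' \<and> c \<in> range \<phi>' \<and>
      (\<forall>z. (\<forall>j\<in>T. z i - u i \<le> z j - u j) \<longrightarrow> \<phi> z \<in> range \<phi>'))"
proof -
  define \<psi> where "\<psi> = (\<lambda>w. \<phi> (\<lambda>i. u i + w i))"
  have \<psi>: "skeleton \<psi>" unfolding \<psi>_def using skeleton_reparam(1)[OF \<phi> permutes_id, of u] by simp
  have sub: "\<phi> w = \<psi> (\<lambda>i. w i - u i)" for w by (simp add: \<psi>_def)
  have "covers c (\<psi> (\<lambda>_. 0))" using c by (simp add: \<psi>_def)
  from skeleton_exchange_0[OF \<psi> this] obtain T where T: "T \<subseteq> {1..n}" "T \<noteq> {}"
    "\<forall>w. c \<le> \<psi> w \<longrightarrow> (\<forall>j\<in>T. 0 < w j)"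
    "\<forall>i\<in>T. \<exists>\<phi>'. skeleton \<phi>' \<and> c \<in> range \<phi>' \<and> (\<forall>z. (\<forall>j\<in>T. z i \<le> z j) \<longrightarrow> \<phi>' z = \<psi> z)"
    by (elim exE conjE)
  have "\<forall>j\<in>T. u j < w j" if "c \<le> \<phi> w" for w
    using T(3)[rule_format, of "\<lambda>i. w i - u i"] that unfolding sub[of w] by simp
  moreover have "\<exists>\<phi>'. skeleton \<phi>' \<and> c \<in> range \<phi>' \<and>
      (\<forall>z. (\<forall>j\<in>T. z i - u i \<le> z j - u j) \<longrightarrow> \<phi> z \<in> range \<phi>')" if i: "i \<in> T" for i
  proof -
    obtain \<phi>' where \<phi>': "skeleton \<phi>'" "c \<in> range \<phi>'"
      "\<forall>z. (\<forall>j\<in>T. z i \<le> z j) \<longrightarrow> \<phi>' z = \<psi> z"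
      using bspec[OF T(4) i] by (elim exE conjE)
    have "\<phi> z \<in> range \<phi>'" if "\<forall>j\<in>T. z i - u i \<le> z j - u j" for z
    proof -
      have "\<phi>' (\<lambda>j. z j - u j) = \<phi> z" unfolding sub[of z] using \<phi>'(3) that by simp
      then show ?thesis by (metis rangeI)
    qed
    then show ?thesis using \<phi>'(1,2) by (intro exI[of _ \<phi>'] conjI allI impI) simp_all
  qed
  ultimately show ?thesis using T(1,2) by blast
qed


section \<open>Two short sets lie in a common skeleton\<close>

text \<open>
  The sets of members of short chains, together with the empty set; being closed under subsets
  they are more convenient than lists.
\<close>

definition short_set :: "'a set \<Rightarrow> bool" where
  "short_set S \<longleftrightarrow> (\<forall>x\<in>S. \<forall>y\<in>S. (x \<le> y \<and> y \<le> asc x) \<or> (y \<le> x \<and> x \<le> asc y))"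

lemma short_set_subset: "short_set S \<Longrightarrow> S' \<subseteq> S \<Longrightarrow> short_set S'"
  unfolding short_set_def by blast

lemma short_set_chamber:
  fixes \<sigma> :: "nat \<Rightarrow> nat" and K :: "nat set"
  assumes \<phi>: "skeleton \<phi>"
  shows "short_set ((\<lambda>k. \<phi> (\<lambda>i. z i + indic (\<sigma> ` {1..k}) i)) ` K)"
  unfolding short_set_def
proof (intro ballI)
  define p where "p k = \<phi> (\<lambda>i. z i + indic (\<sigma> ` {1..k}) i)" for k
  have le: "p k \<le> p l \<and> p l \<le> asc (p k)" if "k \<le> l" for k l
  proof -
    have sub: "\<sigma> ` {1..k} \<subseteq> \<sigma> ` {1..l}" using that by (intro image_mono) simp
    have "indic (\<sigma> ` {1..k}) i \<le> indic (\<sigma> ` {1..l}) i" "indic (\<sigma> ` {1..l}) i \<le> indic (\<sigma> ` {1..k}) i + 1" for i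
      using subsetD[OF sub, of i] by (simp_all add: of_bool_def del: atLeastAtMost_iff)
    then show ?thesis
      unfolding p_def skeleton_asc[OF \<phi>, symmetric] skeleton_le_iff[OF \<phi>] by (simp add: add.assoc)
  qed
  fix x y assume "x \<in> (\<lambda>k. \<phi> (\<lambda>i. z i + indic (\<sigma> ` {1..k}) i)) ` K"
    "y \<in> (\<lambda>k. \<phi> (\<lambda>i. z i + indic (\<sigma> ` {1..k}) i)) ` K"
  then obtain k l where "x = p k" "y = p l" by (auto simp: p_def)
  then show "(x \<le> y \<and> y \<le> asc x) \<or> (y \<le> x \<and> x \<le> asc y)"
    using le[of k l] le[of l k] linear[of k l] by blast
qed

text \<open>
  The simplex \<open>X\<close> may lie anywhere in the skeleton, whereas \<open>Y\<close> is a short chain ending in \<open>y\<close>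
  that is being extended by \<open>c\<close>. The coordinate differences \<open>(g x i - u i) - (g x j - u j)\<close> change by
  at most one between members of \<open>X\<close>, so for each pair \<open>i\<close>, \<open>j\<close> they do not change sign; the index
  \<open>i \<in> T\<close> that minimizes the sum of \<open>g x i - u i\<close> over \<open>X\<close> therefore minimizes \<open>g x i - u i\<close> for
  every \<open>x \<in> X\<close>. Exchanging the \<open>i\<close>-th ray then keeps \<open>X\<close>. It keeps \<open>Y\<close> for every \<open>i \<in> T\<close>, because the
  members of \<open>Y\<close> have the same coordinates in \<open>T\<close> as \<open>y\<close>.
\<close>

lemma skeleton_add_cover:
  assumes \<phi>: "skeleton \<phi>" and X: "X \<subseteq> range \<phi>" "finite X" "short_set X"
    and Y: "Y \<subseteq> range \<phi>" "y \<in> range \<phi>" "\<And>y'. y' \<in> Y \<Longrightarrow> y' \<le> y \<and> c \<le> asc y'"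
    and c: "covers c y"
  shows "\<exists>\<phi>'. skeleton \<phi>' \<and> X \<union> Y \<union> {c} \<subseteq> range \<phi>'"
proof -
  obtain u where u: "y = \<phi> u" using Y by blast
  obtain T where T: "T \<subseteq> {1..n}" "T \<noteq> {}" "\<And>w. c \<le> \<phi> w \<Longrightarrow> \<forall>j\<in>T. u j < w j"
    "\<And>i. i \<in> T \<Longrightarrow> \<exists>\<phi>'. skeleton \<phi>' \<and> c \<in> range \<phi>' \<and>
      (\<forall>z. (\<forall>j\<in>T. z i - u i \<le> z j - u j) \<longrightarrow> \<phi> z \<in> range \<phi>')"
    using skeleton_exchange[OF \<phi>, of c u] c u by blast
  define g where "g x = (SOME z. x = \<phi> z)" for x
  have g: "x = \<phi> (g x)" if "x \<in> X" for x
  proof -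
    have "\<exists>z. x = \<phi> z" using X(1) that by blast
    then show ?thesis unfolding g_def by (rule someI_ex)
  qed
  define f where "f j = (\<Sum>x\<in>X. g x j - u j)" for j
  have "finite T" using T(1) finite_subset by blast
  then obtain i where i: "i \<in> T" and min: "\<And>j. j \<in> T \<Longrightarrow> f i \<le> f j"
    using ex_is_arg_min_if_finite[of T f] T(2) by (auto simp: is_arg_min_linorder)
  have gX: "g x i - u i \<le> g x j - u j" if x: "x \<in> X" and j: "j \<in> T" for x j
  proof (rule ccontr)
    assume neg: "\<not> g x i - u i \<le> g x j - u j"
    have "\<exists>w\<in>X. g w i - u i < g w j - u j"
    proof (rule ccontr)
      assume "\<not> ?thesis"
      then have "f j < f i" unfolding f_def using X(2) x neg
        by (intro sum_strict_mono_ex1) (auto simp: not_less not_le)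
      then show False using min[OF j] by simp
    qed
    then obtain w where w: "w \<in> X" "g w i - u i < g w j - u j" by blast
    have ij: "i \<in> {1..n}" "j \<in> {1..n}" using i j T(1) by auto
    have "(x \<le> w \<and> w \<le> asc x) \<or> (w \<le> x \<and> x \<le> asc w)"
      using X(3) x w(1) by (auto simp: short_set_def)
    then have "(\<phi> (g x) \<le> \<phi> (g w) \<and> \<phi> (g w) \<le> asc (\<phi> (g x))) \<or>
      (\<phi> (g w) \<le> \<phi> (g x) \<and> \<phi> (g x) \<le> asc (\<phi> (g w)))"
      using g[OF x] g[OF w(1)] by metis
    then have "(g x i \<le> g w i \<and> g w j \<le> g x j + 1) \<or> (g w j \<le> g x j \<and> g x i \<le> g w i + 1)"
      unfolding skeleton_asc[OF \<phi>, symmetric] skeleton_le_iff[OF \<phi>] using ij by blast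
    then show False using neg w(2) by linarith
  qed
  obtain \<phi>' where \<phi>': "skeleton \<phi>'" "c \<in> range \<phi>'"
    "\<And>z. \<forall>j\<in>T. z i - u i \<le> z j - u j \<Longrightarrow> \<phi> z \<in> range \<phi>'"
    using T(4)[OF i] by blast
  have "X \<subseteq> range \<phi>'"
  proof
    fix x assume "x \<in> X"
    then show "x \<in> range \<phi>'" using \<phi>'(3)[of "g x"] gX g by metis
  qed
  moreover have "Y \<subseteq> range \<phi>'"
  proof
    fix y' assume y': "y' \<in> Y"
    then obtain w where w: "y' = \<phi> w" using Y by blast
    have "\<phi> w \<le> \<phi> u" "c \<le> \<phi> (\<lambda>k. w k + 1)"
      using Y(3)[OF y'] w u by (auto simp: skeleton_asc[OF \<phi>])
    then have "w j = u j" if "j \<in> T" for j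
      using T(1) T(3)[of "\<lambda>k. w k + 1"] that unfolding skeleton_le_iff[OF \<phi>] by force
    then show "y' \<in> range \<phi>'" using \<phi>'(3)[of w] i w by simp
  qed
  ultimately show ?thesis using \<phi>' by blast
qed

text \<open>
  The chain \<open>Y\<close> grows by one cover at a time from its top \<open>y\<close> to \<open>d\<close>; it stays below \<open>asc\<close> of each of
  its members because \<open>d\<close> does.
\<close>

lemma skeleton_add_next:
  assumes X: "finite X" "short_set X"
  shows "skeleton \<phi> \<Longrightarrow> X \<subseteq> range \<phi> \<Longrightarrow> Y \<subseteq> range \<phi> \<Longrightarrow> y \<in> Y \<Longrightarrow> y \<le> d
    \<Longrightarrow> (\<And>y'. y' \<in> Y \<Longrightarrow> y' \<le> y \<and> d \<le> asc y')
    \<Longrightarrow> \<exists>\<phi>'. skeleton \<phi>' \<and> X \<union> Y \<union> {d} \<subseteq> range \<phi>'"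
proof (induction "nat (height d - height y)" arbitrary: \<phi> Y y)
  case 0
  then have "y = d" by (intro height_le_eq) auto
  then show ?case using 0 by blast
next
  case (Suc k)
  then have "y \<noteq> d" "y \<le> d" by auto
  then have "y < d" by (rule order.not_eq_order_implies_strict)
  then obtain c where c: "covers c y" "c \<le> d" using cover_between by blast
  have "y \<in> range \<phi>" "\<And>y'. y' \<in> Y \<Longrightarrow> y' \<le> y \<and> c \<le> asc y'"
    using Suc.prems c by (auto intro: order_trans)
  from skeleton_add_cover[OF Suc.prems(1,2) X Suc.prems(3) this c(1)]
  obtain \<phi>' where \<phi>': "skeleton \<phi>'" "X \<union> Y \<union> {c} \<subseteq> range \<phi>'" by blast
  have "\<exists>\<phi>''. skeleton \<phi>'' \<and> X \<union> insert c Y \<union> {d} \<subseteq> range \<phi>''"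
  proof (rule Suc.hyps(1)[OF _ \<phi>'(1)])
    show "k = nat (height d - height c)" using Suc.hyps(2) height_covers[OF c(1)] by simp
    fix y' assume "y' \<in> insert c Y"
    then show "y' \<le> c \<and> d \<le> asc y'"
    proof
      assume "y' = c"
      then show ?thesis using Suc.prems(6)[OF Suc.prems(4)] covers_le[OF c(1)]
        by (metis asc_mono_iff order.refl order_trans)
    next
      assume "y' \<in> Y"
      then show ?thesis using Suc.prems(6) covers_le[OF c(1)] by (blast intro: order_trans)
    qed
  qed (use \<phi>' c in auto)
  then show ?case by blast
qed

text \<open>
  Here \<open>d\<close> may be far above \<open>y\<close>, so the intermediate covers need not form a short chain; each is
  dropped as soon as the next one has been reached.
\<close>

lemma skeleton_add_above:
  assumes X: "finite X" "short_set X"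
  shows "skeleton \<phi> \<Longrightarrow> X \<subseteq> range \<phi> \<Longrightarrow> y \<in> range \<phi> \<Longrightarrow> y \<le> d
    \<Longrightarrow> \<exists>\<phi>'. skeleton \<phi>' \<and> X \<union> {d} \<subseteq> range \<phi>'"
proof (induction "nat (height d - height y)" arbitrary: \<phi> y)
  case 0
  then have "y = d" by (intro height_le_eq) auto
  then show ?case using 0 by blast
next
  case (Suc k)
  then have "y \<noteq> d" "y \<le> d" by auto
  then have "y < d" by (rule order.not_eq_order_implies_strict)
  then obtain c where c: "covers c y" "c \<le> d" using cover_between by blast
  obtain \<phi>' where \<phi>': "skeleton \<phi>'" "X \<union> {} \<union> {c} \<subseteq> range \<phi>'"
    using skeleton_add_cover[OF Suc.prems(1,2) X, of "{}" y c] Suc.prems c by blast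
  show ?case
    by (rule Suc.hyps(1)[OF _ \<phi>'(1), of c]) (use \<phi>' c Suc.hyps(2) height_covers[OF c(1)] in auto)
qed

text \<open>
  Some negative power of \<open>asc\<close> moves a point of the skeleton below \<open>d\<close>, and from there \<open>d\<close> is reached
  along a saturated chain.
\<close>

lemma skeleton_add:
  assumes "skeleton \<phi>" "X \<subseteq> range \<phi>" and X: "finite X" "short_set X"
  shows "\<exists>\<phi>'. skeleton \<phi>' \<and> X \<union> {d} \<subseteq> range \<phi>'"
proof -
  define x where "x = \<phi> (\<lambda>_. 0)"
  obtain k where "x \<le> asc_pow (int k) (inf x d)" using le_asc_pow[of "inf x d" x] by auto
  then have "asc_pow (- int k) x \<le> d" by (simp add: asc_pow_le_shift asc_pow_inf)
  moreover have "asc_pow (- int k) x \<in> range \<phi>" by (simp add: skeleton_range_pow[OF assms(1)] x_def)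
  ultimately show ?thesis using skeleton_add_above[OF X assms(1,2)] by blast
qed

lemma skeleton_add_short:
  assumes "skeleton \<phi>" "X \<subseteq> range \<phi>" and X: "finite X" "short_set X"
  shows "finite Y \<Longrightarrow> short_set Y \<Longrightarrow> \<exists>\<phi>'. skeleton \<phi>' \<and> X \<union> Y \<subseteq> range \<phi>'"
proof (induction "card Y" arbitrary: Y)
  case 0
  then show ?case using assms by auto
next
  case (Suc k)
  have greatest: "\<exists>d\<in>Z. \<forall>y\<in>Z. y \<le> d" if Z: "finite Z" "Z \<noteq> {}" "short_set Z" for Z
  proof -
    obtain d where d: "d \<in> Z" "\<And>y. y \<in> Z \<Longrightarrow> d \<le> y \<Longrightarrow> d = y"
      using finite_has_maximal[OF Z(1,2)] by blast
    then have "y \<le> d" if "y \<in> Z" for y using Z(3) that unfolding short_set_def by blast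
    then show ?thesis using d by blast
  qed
  obtain d where d: "d \<in> Y" "\<And>y. y \<in> Y \<Longrightarrow> y \<le> d"
    using greatest[of Y] Suc by force
  define Z where "Z = Y - {d}"
  have Z: "finite Z" "short_set Z" "card Z = k" "Y = insert d Z" "d \<notin> Z"
    using Suc d short_set_subset[of Y Z] by (auto simp: Z_def)
  obtain \<phi>' where \<phi>': "skeleton \<phi>'" "X \<union> Z \<subseteq> range \<phi>'" using Suc.hyps(1)[of Z] Z by blast
  show ?case
  proof (cases "Z = {}")
    case True
    then show ?thesis using skeleton_add[of \<phi>' X d] \<phi>' X Z(4) by auto
  next
    case False
    then obtain y where y: "y \<in> Z" "\<And>y'. y' \<in> Z \<Longrightarrow> y' \<le> y" using greatest[of Z] Z by blast
    have "y' \<le> y \<and> d \<le> asc y'" if "y' \<in> Z" for y'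
    proof -
      have "(y' \<le> d \<and> d \<le> asc y') \<or> (d \<le> y' \<and> y' \<le> asc d)"
        using Suc.prems(2) that Z(4) unfolding short_set_def by blast
      moreover have "d \<le> y' \<Longrightarrow> d = y'" using d(2)[of y'] that Z(4) by auto
      ultimately show ?thesis using y(2)[OF that] that Z(5) by auto
    qed
    moreover have "y \<le> d" using d y Z(4) by blast
    ultimately obtain \<phi>'' where "skeleton \<phi>''" "X \<union> Z \<union> {d} \<subseteq> range \<phi>''"
      using skeleton_add_next[OF X \<phi>'(1), of Z y d] \<phi>'(2) y(1) by blast
    then show ?thesis using Z(4) by auto
  qed
qed

text \<open>
  The greedy choice of a basis: while the join \<open>t\<close> of the covers chosen so far is not above \<open>asc x\<close>,
  some cover of \<open>x\<close> is not below \<open>t\<close>, and adding it raises the height by one.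
\<close>

lemma independent_covers:
  fixes x :: 'a
  shows "k \<le> n \<Longrightarrow> \<exists>h t. (\<forall>i\<in>{1..k}. covers (h i) x) \<and> t \<le> asc x \<and> x \<le> t \<and> height t = height x + int k \<and>
    (\<forall>b. x \<le> b \<and> (\<forall>i\<in>{1..k}. h i \<le> b) \<longrightarrow> t \<le> b)"
proof (induction k)
  case 0
  show ?case using le_asc by (intro exI[of _ undefined] exI[of _ x]) auto
next
  case (Suc k)
  then obtain h t where h: "\<And>i. i \<in> {1..k} \<Longrightarrow> covers (h i) x" and t: "t \<le> asc x" "x \<le> t" "height t = height x + int k"
    and "\<forall>b. x \<le> b \<and> (\<forall>i\<in>{1..k}. h i \<le> b) \<longrightarrow> t \<le> b"
    using Suc_leD[OF Suc.prems] by blast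
  then have least: "\<And>b. x \<le> b \<Longrightarrow> (\<And>i. i \<in> {1..k} \<Longrightarrow> h i \<le> b) \<Longrightarrow> t \<le> b" by blast
  have "\<not> asc x \<le> t" using t height_mono[of "asc x" t] height_asc[of x] Suc.prems by auto
  then obtain c where c: "covers c x" "\<not> c \<le> t" using asc_le_iff by blast
  have cov: "covers (sup t c) t" by (rule covers_sup[OF c(1) t(2) c(2)])
  define h' where "h' = h(Suc k := c)"
  have "\<forall>i\<in>{1..Suc k}. covers (h' i) x" using h c by (auto simp: h'_def le_Suc_eq)
  moreover have "sup t c \<le> asc x" using t c covers_le_asc by simp
  moreover have "height (sup t c) = height x + int (Suc k)" using height_covers[OF cov] t by simp
  moreover have "sup t c \<le> b" if "x \<le> b" "\<forall>i\<in>{1..Suc k}. h' i \<le> b" for b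
  proof (rule le_supI)
    show "t \<le> b"
    proof (rule least[OF that(1)])
      fix i assume "i \<in> {1..k}"
      then show "h i \<le> b" using that(2)[rule_format, of i] by (simp add: h'_def)
    qed
    show "c \<le> b" using that(2)[rule_format, of "Suc k"] by (simp add: h'_def)
  qed
  ultimately show ?case using t(2) by (intro exI[of _ h'] exI[of _ "sup t c"]) (auto intro: le_supI1)
qed

lemma skeleton_exists: "\<exists>\<phi>. skeleton \<phi>"
proof -
  define x :: 'a where "x = undefined"
  obtain h t where h: "\<And>i. i \<in> {1..n} \<Longrightarrow> covers (h i) x" and t: "t \<le> asc x" "height t = height x + int n"
    and "\<forall>b. x \<le> b \<and> (\<forall>i\<in>{1..n}. h i \<le> b) \<longrightarrow> t \<le> b"
    using independent_covers[of n x] by blast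
  then have least: "\<And>b. x \<le> b \<Longrightarrow> (\<And>i. i \<in> {1..n} \<Longrightarrow> h i \<le> b) \<Longrightarrow> t \<le> b" by blast
  have tx: "t = asc x" using height_le_eq[OF t(1)] t(2) height_asc by simp
  have "\<exists>\<rho>. ray x \<rho> \<and> \<rho> 1 = h i" if "i \<in> {1..n}" for i
  proof -
    define G where "G m = asc_pow (int (Suc m)) x" for m
    have "\<exists>\<rho>. ray x \<rho> \<and> \<rho> 1 = h i \<and> (\<forall>m. \<rho> (Suc m) \<le> G m)"
    proof (rule ray_exists[OF h[OF that]])
      show "h i \<le> G 0" using covers_le_asc[OF h[OF that]] by (simp add: G_def asc_pow_1)
      have *: "asc (G m) = G (Suc m)" for m
        unfolding G_def using asc_pow_Suc[of "int (Suc m)" x] by (simp add: add.commute)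
      show "G m \<le> G (Suc m)" for m unfolding *[symmetric] by (rule le_asc)
      show "asc (G m) \<le> sup (G (Suc m)) (asc x)" for m unfolding * by simp
    qed
    then show ?thesis by blast
  qed
  then obtain \<rho> where \<rho>: "\<And>i. i \<in> {1..n} \<Longrightarrow> ray x (\<rho> i) \<and> \<rho> i 1 = h i" by metis
  have "asc x \<le> b" if b: "\<And>i. i \<in> {1..n} \<Longrightarrow> \<rho> i 1 \<le> b" for b
  proof -
    have "h i \<le> b" if "i \<in> {1..n}" for i using b \<rho> that by metis
    moreover have "x \<le> b" using calculation[of 1] covers_le[OF h, of 1] n_pos by (auto intro: order_trans)
    ultimately show ?thesis using least tx by blast
  qed
  then show ?thesis using skeleton_of_rays[of x \<rho>] \<rho> by blast
qed

lemma common_skeleton: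
  assumes "finite X" "short_set X" "finite Y" "short_set Y"
  shows "\<exists>\<phi>. skeleton \<phi> \<and> X \<union> Y \<subseteq> range \<phi>"
proof -
  obtain \<phi>0 where "skeleton \<phi>0" using skeleton_exists by blast
  then obtain \<phi> where "skeleton \<phi>" "X \<subseteq> range \<phi>"
    using skeleton_add_short[of \<phi>0 "{}" X] assms by (auto simp: short_set_def)
  then show ?thesis using skeleton_add_short assms by blast
qed

end


section \<open>Coordinates along a short set\<close>

text \<open>
  Sort the elements of \<open>{1..n}\<close> by the number of members of the chain that miss them; every member of
  the chain is then an initial segment of the sorted list.
\<close>

lemma chain_of_subsets_permutation:
  fixes \<S> :: "nat set set"
  assumes fin: "finite \<S>" and sub: "\<And>S. S \<in> \<S> \<Longrightarrow> S \<subseteq> {1..n}"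
    and chain: "\<And>S S'. S \<in> \<S> \<Longrightarrow> S' \<in> \<S> \<Longrightarrow> S \<subseteq> S' \<or> S' \<subseteq> S"
  shows "\<exists>\<sigma>. \<sigma> permutes {1..n} \<and> (\<forall>S\<in>\<S>. S = \<sigma> ` {1..card S})"
proof -
  define key where "key i = card {S \<in> \<S>. i \<notin> S}" for i
  define xs where "xs = sort_key key [1..<Suc n]"
  have xs: "distinct xs" "set xs = {1..n}" "length xs = n" by (auto simp: xs_def)
  have sorted: "sorted (map key xs)" by (simp add: xs_def)
  define \<sigma> where "\<sigma> j = (if j \<in> {1..n} then xs ! (j - 1) else j)" for j
  have "bij_betw \<sigma> {1..n} {1..n}"
  proof (rule bij_betw_imageI)
    show "inj_on \<sigma> {1..n}"
      using xs(1,3) by (auto simp: inj_on_def \<sigma>_def nth_eq_iff_index_eq)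
    show "\<sigma> ` {1..n} = {1..n}"
    proof (intro equalityI subsetI)
      fix i assume "i \<in> \<sigma> ` {1..n}"
      then obtain j where j: "j \<in> {1..n}" "i = xs ! (j - 1)" by (auto simp: \<sigma>_def)
      then have "j - 1 < length xs" using xs(3) by auto
      then show "i \<in> {1..n}" using j(2) xs(2) nth_mem by metis
    next
      fix i assume "i \<in> {1..n}"
      then obtain j where "j < n" "i = xs ! j" using xs(2,3) by (metis in_set_conv_nth)
      then have "i = \<sigma> (Suc j)" "Suc j \<in> {1..n}" by (auto simp: \<sigma>_def)
      then show "i \<in> \<sigma> ` {1..n}" by blast
    qed
  qed
  then have perm: "\<sigma> permutes {1..n}" by (rule bij_imp_permutes) (auto simp: \<sigma>_def)
  have "S = \<sigma> ` {1..card S}" if S: "S \<in> \<S>" for S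
  proof -
    define J where "J = {j \<in> {1..n}. \<sigma> j \<in> S}"
    have down: "i' \<in> S" if "i \<in> S" "key i' \<le> key i" for i i'
    proof (rule ccontr)
      assume "i' \<notin> S"
      then have "{S' \<in> \<S>. i \<notin> S'} \<subset> {S' \<in> \<S>. i' \<notin> S'}" using chain[OF S] S that(1) by blast
      then have "key i < key i'" unfolding key_def using fin by (intro psubset_card_mono) auto
      then show False using that(2) by simp
    qed
    have J_down: "j' \<in> J" if "j \<in> J" "1 \<le> j'" "j' \<le> j" for j j'
    proof -
      have j: "j \<in> {1..n}" "\<sigma> j \<in> S" and j': "j' \<in> {1..n}" using that by (auto simp: J_def)
      have "key (\<sigma> j') \<le> key (\<sigma> j)"
        using sorted_nth_mono[OF sorted, of "j' - 1" "j - 1"] j j' that xs(3) by (auto simp: \<sigma>_def)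
      then show ?thesis using down j j' by (auto simp: J_def)
    qed
    have SJ: "S = \<sigma> ` J"
    proof (intro equalityI subsetI)
      fix i assume i: "i \<in> S"
      then have "inv \<sigma> i \<in> {1..n}" using sub[OF S] permutes_in_image[OF permutes_inv[OF perm]] by blast
      then have "inv \<sigma> i \<in> J" "i = \<sigma> (inv \<sigma> i)"
        using i permutes_inverses(1)[OF perm] by (auto simp: J_def)
      then show "i \<in> \<sigma> ` J" by blast
    qed (auto simp: J_def)
    have "card S = card J"
      unfolding SJ by (intro card_image inj_on_subset[OF permutes_inj[OF perm]]) simp
    moreover have "J = {1..card J}"
    proof (cases "J = {}")
      case False
      have fJ: "finite J" by (simp add: J_def)
      have "J = {1..Max J}"
      proof (intro equalityI subsetI)
        fix j assume "j \<in> J"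
        then show "j \<in> {1..Max J}" using fJ by (auto simp: J_def)
      next
        fix j assume "j \<in> {1..Max J}"
        then show "j \<in> J" using J_down[OF Max_in[OF fJ False]] by simp
      qed
      then show ?thesis by (metis card_atLeastAtMost diff_Suc_1)
    qed simp
    ultimately show ?thesis using SJ by simp
  qed
  then show ?thesis using perm by blast
qed

context uniform_modular
begin

text \<open>
  Relative to the least element \<open>\<phi> u\<close>, the members of a short set have coordinates in \<open>{0, 1}\<close>, and
  their supports form a chain.
\<close>

lemma skeleton_short_coordinates:
  assumes \<phi>: "skeleton \<phi>" and S: "S \<subseteq> range \<phi>" "finite S" "S \<noteq> {}" "short_set S"
  shows "\<exists>u \<sigma>. \<sigma> permutes {1..n} \<and> \<phi> u \<in> S \<and>
    (\<forall>x\<in>S. \<exists>k\<le>n. x = \<phi> (\<lambda>i. u i + indic (\<sigma> ` {1..k}) i))"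
proof -
  obtain x0 where x0: "x0 \<in> S" "\<And>y. y \<in> S \<Longrightarrow> y \<le> x0 \<Longrightarrow> x0 = y"
    using finite_has_minimal[OF S(2,3)] by blast
  obtain u where u: "x0 = \<phi> u" using x0 S(1) by blast
  define g where "g x = (SOME z. x = \<phi> z)" for x
  have g: "x = \<phi> (g x)" if "x \<in> S" for x
  proof -
    have "\<exists>z. x = \<phi> z" using S(1) that by blast
    then show ?thesis unfolding g_def by (rule someI_ex)
  qed
  define D where "D x = {i \<in> {1..n}. u i < g x i}" for x
  have gD: "g x i = u i + indic (D x) i" if "x \<in> S" "i \<in> {1..n}" for x i
  proof -
    have "x0 \<le> x \<and> x \<le> asc x0"
      using S(4) x0(1) x0(2)[OF that(1)] that(1) le_asc[of x0] unfolding short_set_def by blast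
    then have "\<phi> u \<le> \<phi> (g x)" "\<phi> (g x) \<le> \<phi> (\<lambda>i. u i + 1)"
      using g[OF that(1)] u by (simp_all add: skeleton_asc[OF \<phi>])
    then have "u i \<le> g x i" "g x i \<le> u i + 1" using that(2) unfolding skeleton_le_iff[OF \<phi>] by blast+
    then show ?thesis using that(2) by (auto simp: D_def)
  qed
  have mono: "D x \<subseteq> D y" if xy: "x \<in> S" "y \<in> S" "x \<le> y" for x y
  proof -
    have "\<phi> (g x) \<le> \<phi> (g y)" using g xy by metis
    then show ?thesis unfolding skeleton_le_iff[OF \<phi>] D_def by force
  qed
  have "\<exists>\<sigma>. \<sigma> permutes {1..n} \<and> (\<forall>T\<in>D ` S. T = \<sigma> ` {1..card T})"
  proof (rule chain_of_subsets_permutation)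
    fix T T' assume "T \<in> D ` S" "T' \<in> D ` S"
    then obtain x y where "x \<in> S" "y \<in> S" "T = D x" "T' = D y" by blast
    then show "T \<subseteq> T' \<or> T' \<subseteq> T" using mono S(4) unfolding short_set_def by blast
  qed (use S(2) in \<open>auto simp: D_def\<close>)
  then obtain \<sigma> where \<sigma>: "\<sigma> permutes {1..n}" and images: "\<forall>T\<in>D ` S. T = \<sigma> ` {1..card T}"
    by (elim exE conjE)
  have D: "D x = \<sigma> ` {1..card (D x)}" if "x \<in> S" for x
    using images imageI[OF that] by (rule bspec)
  have "\<exists>k\<le>n. x = \<phi> (\<lambda>i. u i + indic (\<sigma> ` {1..k}) i)" if x: "x \<in> S" for x
  proof (intro exI[of _ "card (D x)"] conjI)
    have "card (D x) \<le> card {1..n}" by (intro card_mono) (auto simp: D_def)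
    then show "card (D x) \<le> n" by simp
    have "\<phi> (g x) = \<phi> (\<lambda>i. u i + indic (\<sigma> ` {1..card (D x)}) i)"
      unfolding D[OF x, symmetric] using gD[OF x] by (intro skeleton_cong[OF \<phi>]) simp
    then show "x = \<phi> (\<lambda>i. u i + indic (\<sigma> ` {1..card (D x)}) i)" using g[OF x] by simp
  qed
  then show ?thesis using \<sigma> x0(1) u by (intro exI[of _ u] exI[of _ \<sigma>]) simp
qed

text \<open>
  Only the range of a skeleton matters for its apartment, so the permutation and the translation of
  the previous lemma can be absorbed into the skeleton.
\<close>

lemma skeleton_normal_form:
  assumes \<phi>: "skeleton \<phi>" and S: "S \<subseteq> range \<phi>" "finite S" "S \<noteq> {}" "short_set S"
  shows "\<exists>\<psi>. skeleton \<psi> \<and> range \<psi> = range \<phi> \<and> \<psi> (\<lambda>_. 0) \<in> S \<and> (\<forall>x\<in>S. \<exists>k\<le>n. x = \<psi> (indic {1..k}))"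
proof -
  obtain u \<sigma> where \<sigma>: "\<sigma> permutes {1..n}" "\<phi> u \<in> S"
    and u: "\<And>x. x \<in> S \<Longrightarrow> \<exists>k\<le>n. x = \<phi> (\<lambda>i. u i + indic (\<sigma> ` {1..k}) i)"
    using skeleton_short_coordinates[OF assms] by blast
  define \<psi> where "\<psi> = (\<lambda>w. \<phi> (\<lambda>i. u i + w (inv \<sigma> i)))"
  have "skeleton \<psi>" "range \<psi> = range \<phi>"
    unfolding \<psi>_def by (rule skeleton_reparam[OF \<phi> permutes_inv[OF \<sigma>(1)]])+
  moreover have "\<psi> (indic {1..k}) = \<phi> (\<lambda>i. u i + indic (\<sigma> ` {1..k}) i)" for k
  proof -
    have "inv \<sigma> i \<in> {1..k} \<longleftrightarrow> i \<in> \<sigma> ` {1..k}" for i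
      using permutes_inverses[OF \<sigma>(1)] by (metis image_iff)
    then show ?thesis unfolding \<psi>_def by presburger
  qed
  moreover have "\<psi> (\<lambda>_. 0) = \<phi> u" by (simp add: \<psi>_def)
  ultimately show ?thesis using \<sigma>(2) u by (intro exI[of _ \<psi>]) simp
qed

lemma sum_indic: "k \<le> n \<Longrightarrow> (\<Sum>i=1..n. indic {1..k} i) = int k"
proof -
  assume "k \<le> n"
  then have "{1..n} \<inter> {i. i \<in> {1..k}} = {1..k}" by auto
  then show ?thesis by (subst sum_of_bool_eq) auto
qed

text \<open>
  The normal form of \<open>\<chi>\<close> along the chamber of \<open>\<phi>\<close> starts at the least element of the chamber, and the
  heights then determine which member of the chamber has which coordinates.
\<close>

lemma skeleton_align:
  assumes \<phi>: "skeleton \<phi>" and \<chi>: "skeleton \<chi>" and sub: "\<And>k. k \<le> n \<Longrightarrow> \<phi> (indic {1..k}) \<in> range \<chi>"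
  shows "\<exists>\<psi>. skeleton \<psi> \<and> range \<psi> = range \<chi> \<and> (\<forall>k\<le>n. \<psi> (indic {1..k}) = \<phi> (indic {1..k}))"
proof -
  define S where "S = (\<lambda>k. \<phi> (indic {1..k})) ` {..n}"
  have "short_set S"
    using short_set_chamber[OF \<phi>, of "\<lambda>_. 0" id "{..n}"] unfolding S_def by simp
  moreover have "S \<subseteq> range \<chi>" "finite S" "S \<noteq> {}" using sub by (auto simp: S_def)
  ultimately obtain \<psi> where \<psi>: "skeleton \<psi>" "range \<psi> = range \<chi>" "\<psi> (\<lambda>_. 0) \<in> S"
    and in_\<psi>: "\<forall>x\<in>S. \<exists>k\<le>n. x = \<psi> (indic {1..k})"
    using skeleton_normal_form[OF \<chi>, of S] by auto
  have height: "height (\<xi> (indic {1..k})) = height (\<xi> (\<lambda>_. 0)) + int k" if "skeleton \<xi>" "k \<le> n" for \<xi> k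
    using skeleton_height[OF that(1), of "indic {1..k}"] sum_indic[OF that(2)] by simp
  have base: "\<psi> (\<lambda>_. 0) = \<phi> (\<lambda>_. 0)"
  proof (rule order.antisym)
    have "\<phi> (\<lambda>_. 0) \<in> S" unfolding S_def by (rule image_eqI[of _ _ 0]) auto
    then obtain k where "\<phi> (\<lambda>_. 0) = \<psi> (indic {1..k})" using in_\<psi> by blast
    then show "\<psi> (\<lambda>_. 0) \<le> \<phi> (\<lambda>_. 0)" by (simp add: skeleton_le_iff[OF \<psi>(1)])
    obtain k where "\<psi> (\<lambda>_. 0) = \<phi> (indic {1..k})" using \<psi>(3) by (auto simp: S_def)
    then show "\<phi> (\<lambda>_. 0) \<le> \<psi> (\<lambda>_. 0)" by (simp add: skeleton_le_iff[OF \<phi>])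
  qed
  have "\<psi> (indic {1..k}) = \<phi> (indic {1..k})" if k: "k \<le> n" for k
  proof -
    have "\<phi> (indic {1..k}) \<in> S" using k by (auto simp: S_def)
    then obtain l where l: "l \<le> n" "\<phi> (indic {1..k}) = \<psi> (indic {1..l})" using in_\<psi> by blast
    then have "k = l" using height[OF \<phi> k] height[OF \<psi>(1) l(1)] base by simp
    then show ?thesis using l by simp
  qed
  then show ?thesis using \<psi> by blast
qed

text \<open>
  The height of the meet of \<open>\<phi> u\<close> with the translate by \<open>m\<close> of \<open>\<phi> (indic {1..k})\<close> is \<open>M u k m\<close> up to a
  constant, and so it is the same for both skeletons. The difference of these numbers for
  \<open>k = j\<close> and \<open>k = j - 1\<close> tells whether \<open>m < u j\<close>.
\<close>

lemma skeleton_coordinates_unique: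
  assumes \<phi>: "skeleton \<phi>" and \<psi>: "skeleton \<psi>" and eq: "\<And>k. k \<le> n \<Longrightarrow> \<phi> (indic {1..k}) = \<psi> (indic {1..k})"
    and x: "\<phi> u = \<psi> v" and j: "j \<in> {1..n}"
  shows "u j = v j"
proof -
  define M where "M u k m = (\<Sum>i=1..n. min (u i) (indic {1..k} i + m))" for u :: "nat \<Rightarrow> int" and k :: nat and m :: int
  have "\<phi> (\<lambda>_. 0) = \<psi> (\<lambda>_. 0)" using eq[of 0] by simp
  then have M: "M u k m = M v k m" if "k \<le> n" for k m
    using skeleton_height[OF \<phi>, of "\<lambda>i. min (u i) (indic {1..k} i + m)"]
      skeleton_height[OF \<psi>, of "\<lambda>i. min (v i) (indic {1..k} i + m)"]
    unfolding M_def skeleton_min[OF \<phi>] skeleton_min[OF \<psi>] skeleton_shift[OF \<phi>] skeleton_shift[OF \<psi>] x eq[OF that]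
    by simp
  have step: "M w j m - M w (j - 1) m = of_bool (m < w j)" for w m
  proof -
    have "M w j m - M w (j - 1) m =
      (\<Sum>i=1..n. min (w i) (indic {1..j} i + m) - min (w i) (indic {1..j - 1} i + m))"
      unfolding M_def by (simp add: sum_subtractf)
    also have "\<dots> = (\<Sum>i=1..n. if i = j then of_bool (m < w j) else 0)"
      using j by (intro sum.cong) (auto simp: min_def)
    also have "\<dots> = of_bool (m < w j)" using j by simp
    finally show ?thesis .
  qed
  have "m < u j \<longleftrightarrow> m < v j" for m
    using step[where w = u and m = m] step[where w = v and m = m] M[of j m] M[of "j - 1" m] j
    by (auto split: if_splits simp: of_bool_def)
  then show ?thesis by (meson less_irrefl linorder_neqE)
qed


end


section \<open>Simplicial isomorphisms and the affine Coxeter complex\<close>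

lemma complex_iso_inv:
  assumes "complex_iso V \<Delta> W \<Gamma> f" shows "complex_iso W \<Gamma> V \<Delta> (inv_into V f)"
proof -
  have bij: "bij_betw f V W" and iso: "\<And>A. A \<subseteq> V \<Longrightarrow> A \<in> \<Delta> \<longleftrightarrow> f ` A \<in> \<Gamma>"
    using assms by (auto simp: complex_iso_def)
  have "B \<in> \<Gamma> \<longleftrightarrow> inv_into V f ` B \<in> \<Delta>" if B: "B \<subseteq> W" for B
  proof -
    have "inv_into V f ` B \<subseteq> V" using B bij_betw_inv_into[OF bij] by (auto simp: bij_betw_def)
    moreover have "f ` inv_into V f ` B = B" using B bij by (metis bij_betw_def image_inv_into_cancel)
    ultimately show ?thesis using iso by metis
  qed
  then show ?thesis using bij_betw_inv_into[OF bij] by (simp add: complex_iso_def)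
qed

lemma complex_iso_comp:
  assumes f: "complex_iso V \<Delta> W \<Gamma> f" and g: "complex_iso W \<Gamma> U \<Theta> g"
  shows "complex_iso V \<Delta> U \<Theta> (g \<circ> f)"
proof -
  have "f ` A \<subseteq> W" if "A \<subseteq> V" for A using f that by (auto simp: complex_iso_def bij_betw_def)
  then have "A \<in> \<Delta> \<longleftrightarrow> (g \<circ> f) ` A \<in> \<Theta>" if "A \<subseteq> V" for A
    using f g that unfolding complex_iso_def image_comp[symmetric] by simp
  then show ?thesis using f g bij_betw_trans by (auto simp: complex_iso_def)
qed

text \<open>
  The real translation constant is a difference of integers as soon as there is a coordinate.
\<close>

lemma mod_ones_iff:
  assumes "1 \<le> n"
  shows "(z, w) \<in> mod_ones n \<longleftrightarrow>
    z \<in> int_vectors n \<and> w \<in> int_vectors n \<and> (\<exists>k. \<forall>i\<in>{1..n}. w i = z i + k)"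
proof -
  have "(\<exists>c::real. \<forall>i\<in>{1..n}. real_of_int (w i) = real_of_int (z i) + c)
    \<longleftrightarrow> (\<exists>k. \<forall>i\<in>{1..n}. w i = z i + k)"
  proof
    assume "\<exists>c::real. \<forall>i\<in>{1..n}. real_of_int (w i) = real_of_int (z i) + c"
    then obtain c :: real where c: "\<And>i. i \<in> {1..n} \<Longrightarrow> real_of_int (w i) = real_of_int (z i) + c" by blast
    have "w i = z i + (w 1 - z 1)" if "i \<in> {1..n}" for i
    proof -
      have "real_of_int (w i) = real_of_int (z i + (w 1 - z 1))"
        using c[OF that] c[of 1] assms by simp
      then show ?thesis by (simp only: of_int_eq_iff)
    qed
    then show "\<exists>k. \<forall>i\<in>{1..n}. w i = z i + k" by blast
  next
    assume "\<exists>k. \<forall>i\<in>{1..n}. w i = z i + k"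
    then obtain k where "\<forall>i\<in>{1..n}. w i = z i + k" by blast
    then show "\<exists>c::real. \<forall>i\<in>{1..n}. real_of_int (w i) = real_of_int (z i) + c"
      by (intro exI[of _ "real_of_int k"]) simp
  qed
  then show ?thesis by (auto simp: mod_ones_def)
qed

lemma equiv_mod_ones: assumes "1 \<le> n" shows "equiv (int_vectors n) (mod_ones n)"
proof (rule equivI)
  show "mod_ones n \<subseteq> int_vectors n \<times> int_vectors n" by (auto simp: mod_ones_def)
  show "refl_on (int_vectors n) (mod_ones n)"
    unfolding refl_on_def mod_ones_def by (auto intro: exI[of _ 0])
  show "sym (mod_ones n)"
  proof (rule symI)
    fix z w assume "(z, w) \<in> mod_ones n"
    then obtain k where "z \<in> int_vectors n" "w \<in> int_vectors n" "\<forall>i\<in>{1..n}. w i = z i + k"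
      using mod_ones_iff[OF assms] by blast
    then show "(w, z) \<in> mod_ones n"
      unfolding mod_ones_iff[OF assms] by (auto intro!: exI[of _ "- k"])
  qed
  show "trans (mod_ones n)"
  proof (rule transI)
    fix x y z assume "(x, y) \<in> mod_ones n" "(y, z) \<in> mod_ones n"
    then obtain k l where "x \<in> int_vectors n" "z \<in> int_vectors n"
      "\<forall>i\<in>{1..n}. y i = x i + k" "\<forall>i\<in>{1..n}. z i = y i + l"
      using mod_ones_iff[OF assms] by metis
    then show "(x, z) \<in> mod_ones n"
      unfolding mod_ones_iff[OF assms] by (auto intro!: exI[of _ "k + l"])
  qed
qed

lemma sum_unit_vec:
  fixes \<sigma> :: "nat \<Rightarrow> nat" and k :: nat
  assumes "inj \<sigma>" shows "(\<Sum>j=1..k. unit_vec (\<sigma> j) i) = indic (\<sigma> ` {1..k}) i"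
proof -
  have "(\<Sum>j=1..k. unit_vec (\<sigma> j) i) = (\<Sum>l\<in>\<sigma> ` {1..k}. if i = l then 1 else 0)"
    unfolding unit_vec_def using assms by (subst sum.reindex) (auto intro: inj_on_subset)
  also have "\<dots> = indic (\<sigma> ` {1..k}) i" using sum.delta'[of "\<sigma> ` {1..k}" i "\<lambda>_. 1 :: int"] by simp
  finally show ?thesis .
qed


section \<open>The complex of the lattice and its apartments\<close>

context uniform_modular
begin

definition asc_class :: "'a \<Rightarrow> 'a set" where
  "asc_class x = asc_equiv `` {x}"

text \<open>
  For \<open>R = UNIV\<close> this is the complex of the lattice, for the range of a skeleton it is an apartment.
\<close>

definition short_complex :: "'a set \<Rightarrow> 'a set set set" where
  "short_complex R = {asc_class ` S |S. S \<subseteq> R \<and> finite S \<and> short_set S}"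

lemma equiv_asc_equiv: "equiv UNIV (asc_equiv :: ('a \<times> 'a) set)"
proof (rule equivI)
  show "refl (asc_equiv :: ('a \<times> 'a) set)"
    unfolding refl_on_def asc_equiv_def using asc_pow_0 by blast
  show "sym (asc_equiv :: ('a \<times> 'a) set)"
    unfolding sym_def asc_equiv_def using asc_pow_cancel(1) by blast
  show "trans (asc_equiv :: ('a \<times> 'a) set)"
  proof (rule transI)
    fix x y z :: 'a assume "(x, y) \<in> asc_equiv" "(y, z) \<in> asc_equiv"
    then obtain k l where "asc_pow k x = y" "asc_pow l y = z" by (auto simp: asc_equiv_def)
    then have "asc_pow (l + k) x = z" by (simp add: asc_pow_add)
    then show "(x, z) \<in> asc_equiv" by (auto simp: asc_equiv_def)
  qed
qed simp

lemma asc_class_eq_iff: "asc_class x = asc_class y \<longleftrightarrow> (\<exists>k. y = asc_pow k x)"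
  unfolding asc_class_def using eq_equiv_class_iff[OF equiv_asc_equiv, of x y] by (auto simp: asc_equiv_def)

lemma lattice_complex_vertices_eq: "lattice_complex_vertices ty = range asc_class"
  unfolding lattice_complex_vertices_def quotient_def asc_class_def by auto

text \<open>
  A short set is turned into a list by sorting it by height.
\<close>

lemma short_chain_iff: "(\<exists>xs. short_chain xs \<and> set xs = S) \<longleftrightarrow> S \<noteq> {} \<and> finite S \<and> short_set S"
proof
  assume "\<exists>xs. short_chain xs \<and> set xs = S"
  then obtain xs where xs: "xs \<noteq> []" "sorted_wrt (<) xs" "last xs \<le> asc (hd xs)" "set xs = S"
    by (auto simp: short_chain_def)
  have le: "xs ! i \<le> xs ! j" if "i \<le> j" "j < length xs" for i j
    using that xs(2) by (cases "i = j") (auto simp: sorted_wrt_iff_nth_less less_imp_le)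
  have index: "\<exists>i. i < length xs \<and> x = xs ! i" if "x \<in> S" for x
    using that xs(4) in_set_conv_nth[of x xs] by auto
  have "short_set S" unfolding short_set_def
  proof (intro ballI)
    have *: "x \<le> y \<Longrightarrow> x \<le> y \<and> y \<le> asc x" if *: "x \<in> S" "y \<in> S" for x y
    proof -
      obtain i j where ij: "i < length xs" "j < length xs" "x = xs ! i" "y = xs ! j"
        using index[OF *(1)] index[OF *(2)] by blast
      have "hd xs \<le> x" using le[of 0 i] ij(1,3) hd_conv_nth[OF xs(1)] by simp
      moreover have "j \<le> length xs - 1" "length xs - 1 < length xs" using ij(2) by linarith+
      then have "y \<le> last xs" using le[of j "length xs - 1"] ij(4) last_conv_nth[OF xs(1)] by simp
      ultimately have "y \<le> asc x" using xs(3) by (meson asc_mono_iff order_trans)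
      then show "x \<le> y \<Longrightarrow> x \<le> y \<and> y \<le> asc x" by blast
    qed
    fix x y assume xy: "x \<in> S" "y \<in> S"
    then obtain i j where "i < length xs" "j < length xs" "x = xs ! i" "y = xs ! j"
      using index by blast
    then have "x \<le> y \<or> y \<le> x" using le[of i j] le[of j i] linear[of i j] by blast
    then show "(x \<le> y \<and> y \<le> asc x) \<or> (y \<le> x \<and> x \<le> asc y)" using *[OF xy] *[OF xy(2,1)] by blast
  qed
  then show "S \<noteq> {} \<and> finite S \<and> short_set S" using xs by auto
next
  assume S: "S \<noteq> {} \<and> finite S \<and> short_set S"
  then obtain ys where ys: "set ys = S" "distinct ys" using finite_distinct_list by blast
  define xs where "xs = sort_key height ys"
  have xs: "set xs = S" "distinct xs" "sorted (map height xs)" using ys by (simp_all add: xs_def)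
  then have "xs \<noteq> []" using S by auto
  have "sorted_wrt (<) xs" unfolding sorted_wrt_iff_nth_less
  proof (intro allI impI)
    fix i j assume ij: "i < j" "j < length xs"
    then have ne: "xs ! i \<noteq> xs ! j" using xs(2) by (simp add: nth_eq_iff_index_eq)
    have height: "height (xs ! i) \<le> height (xs ! j)" using sorted_nth_mono[OF xs(3), of i j] ij by simp
    have "xs ! i \<in> S" "xs ! j \<in> S" using ij xs(1) by auto
    then have "xs ! i \<le> xs ! j \<or> xs ! j \<le> xs ! i" using S unfolding short_set_def by blast
    then show "xs ! i < xs ! j" using ne height height_le_eq[of "xs ! j" "xs ! i"] by (auto simp: order.order_iff_strict)
  qed
  moreover have "last xs \<le> asc (hd xs)"
  proof -
    have "hd xs \<in> S" "last xs \<in> S" using xs(1) \<open>xs \<noteq> []\<close> by auto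
    then show ?thesis using S le_asc[of "hd xs"] unfolding short_set_def by (blast intro: order_trans)
  qed
  ultimately show "\<exists>xs. short_chain xs \<and> set xs = S"
    using \<open>xs \<noteq> []\<close> xs(1) unfolding short_chain_def by blast
qed

lemma lattice_complex_eq: "lattice_complex ty = short_complex UNIV"
proof -
  have "lattice_complex ty = insert {} {asc_class ` S |S. \<exists>xs. short_chain xs \<and> set xs = S}"
    unfolding lattice_complex_def asc_class_def by blast
  also have "\<dots> = short_complex UNIV"
    unfolding short_chain_iff short_complex_def by (auto simp: short_set_def)
  finally show ?thesis .
qed

lemma singleton_short_complex: "x \<in> R \<Longrightarrow> {asc_class x} \<in> short_complex R"
  unfolding short_complex_def using le_asc[of x]
  by (intro CollectI exI[of _ "{x}"]) (simp add: short_set_def)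

lemma Union_short_complex: "\<Union> (short_complex R) = asc_class ` R"
proof -
  have "asc_class ` R \<subseteq> \<Union> (short_complex R)" using singleton_short_complex by blast
  moreover have "\<Union> (short_complex R) \<subseteq> asc_class ` R" by (auto simp: short_complex_def)
  ultimately show ?thesis by blast
qed

lemma simplicial_short_complex:
  assumes "R \<noteq> {}" shows "simplicial_complex (asc_class ` R) (short_complex R)"
  unfolding simplicial_complex_def
proof (intro conjI ballI allI impI)
  fix A B assume "A \<in> short_complex R" "B \<subseteq> A"
  then obtain S where "B \<subseteq> asc_class ` S" "S \<subseteq> R" "finite S" "short_set S"
    by (auto simp: short_complex_def)
  then obtain S' where "B = asc_class ` S'" "S' \<subseteq> R" "finite S'" "short_set S'"
    by (metis finite_subset short_set_subset subset_image_iff order_trans)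
  then show "B \<in> short_complex R" by (auto simp: short_complex_def)
next
  fix v assume "v \<in> asc_class ` R"
  then obtain x where "x \<in> R" "v = asc_class x" by blast
  then show "{v} \<in> short_complex R" using singleton_short_complex by simp
qed (use assms in \<open>auto simp: short_complex_def\<close>)

text \<open>
  A simplex may use the vertex of \<open>\<psi> (indic {1..n})\<close>, which is \<open>asc (\<psi> (indic {1..0}))\<close>; modulo powers
  of \<open>asc\<close> it is the vertex with index \<open>0\<close>, so indices below \<open>n\<close> suffice.
\<close>

lemma short_complex_chamber:
  assumes \<phi>: "skeleton \<phi>" and A: "A \<in> short_complex (range \<phi>)"
  shows "\<exists>\<psi>. skeleton \<psi> \<and> range \<psi> = range \<phi> \<and> A \<subseteq> (\<lambda>k. asc_class (\<psi> (indic {1..k}))) ` {..<n}"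
proof -
  obtain S where S: "A = asc_class ` S" "S \<subseteq> range \<phi>" "finite S" "short_set S"
    using A by (auto simp: short_complex_def)
  show ?thesis
  proof (cases "S = {}")
    case True then show ?thesis using \<phi> S by auto
  next
    case False
    then obtain \<psi> where \<psi>: "skeleton \<psi>" "range \<psi> = range \<phi>" "\<And>x. x \<in> S \<Longrightarrow> \<exists>k\<le>n. x = \<psi> (indic {1..k})"
      using skeleton_normal_form[OF \<phi> S(2,3) False S(4)] by blast
    have top: "asc_class (\<psi> (indic {1..n})) = asc_class (\<psi> (indic {1..0}))"
    proof -
      have "\<psi> (indic {1..n}) = \<psi> (\<lambda>i. indic {1..0} i + 1)" by (intro skeleton_cong[OF \<psi>(1)]) simp
      then have "\<psi> (indic {1..n}) = asc_pow 1 (\<psi> (indic {1..0}))" by (simp only: skeleton_shift[OF \<psi>(1)])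
      then show ?thesis using asc_class_eq_iff by metis
    qed
    have "asc_class x \<in> (\<lambda>k. asc_class (\<psi> (indic {1..k}))) ` {..<n}" if x: "x \<in> S" for x
    proof -
      obtain k where k: "k \<le> n" "x = \<psi> (indic {1..k})" using \<psi>(3)[OF x] by blast
      show ?thesis
      proof (cases "k = n")
        case True
        then have "asc_class x = asc_class (\<psi> (indic {1..0}))" using k top by simp
        then show ?thesis using n_pos by (intro image_eqI[of _ _ 0]) auto
      next
        case False
        then show ?thesis using k by (intro image_eqI[of _ _ k]) auto
      qed
    qed
    then show ?thesis using \<psi> S(1) by blast
  qed
qed

text \<open>
  The vertices of the Coxeter complex are classes of vectors; any representative gives the same
  value when \<open>\<phi>\<close> is a skeleton.
\<close>

definition vertex_map :: "((nat \<Rightarrow> int) \<Rightarrow> 'a) \<Rightarrow> (nat \<Rightarrow> int) set \<Rightarrow> 'a set" where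
  "vertex_map \<phi> c = asc_class (\<phi> (SOME z. z \<in> c))"

definition truncate :: "(nat \<Rightarrow> int) \<Rightarrow> nat \<Rightarrow> int" where
  "truncate z = (\<lambda>i. if i \<in> {1..n} then z i else 0)"

lemma truncate_in: "truncate z \<in> int_vectors n"
  by (simp add: truncate_def int_vectors_def)

lemma skeleton_truncate: "skeleton \<phi> \<Longrightarrow> \<phi> (truncate z) = \<phi> z"
  by (intro skeleton_cong) (simp_all add: truncate_def)

lemma vertex_map_eq:
  assumes \<phi>: "skeleton \<phi>" and z: "z \<in> int_vectors n"
  shows "vertex_map \<phi> (mod_ones n `` {z}) = asc_class (\<phi> z)"
proof -
  define w where "w = (SOME w. w \<in> mod_ones n `` {z})"
  have "z \<in> mod_ones n `` {z}" using equiv_class_self[OF equiv_mod_ones[OF n_pos] z] .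
  then have "w \<in> mod_ones n `` {z}"
    unfolding w_def by (rule someI[where P = "\<lambda>w. w \<in> mod_ones n `` {z}"])
  then obtain k where "\<forall>i\<in>{1..n}. w i = z i + k" by (auto simp: mod_ones_iff[OF n_pos])
  then have "\<phi> w = \<phi> (\<lambda>i. z i + k)" by (intro skeleton_cong[OF \<phi>]) simp
  then have "\<phi> w = asc_pow k (\<phi> z)" by (simp add: skeleton_shift[OF \<phi>])
  then have "asc_class (\<phi> z) = asc_class (\<phi> w)" using asc_class_eq_iff by blast
  then show ?thesis by (simp add: vertex_map_def w_def)
qed

lemma vertex_map_inj:
  assumes \<phi>: "skeleton \<phi>" and z: "z \<in> int_vectors n" and w: "w \<in> int_vectors n"
    and eq: "asc_class (\<phi> z) = asc_class (\<phi> w)"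
  shows "mod_ones n `` {z} = mod_ones n `` {w}"
proof -
  obtain k where "\<phi> w = asc_pow k (\<phi> z)" using eq asc_class_eq_iff by blast
  then have "\<phi> w = \<phi> (\<lambda>i. z i + k)" by (simp add: skeleton_shift[OF \<phi>])
  then have "\<forall>i\<in>{1..n}. w i = z i + k" by (simp add: skeleton_eq_iff[OF \<phi>])
  then have "(z, w) \<in> mod_ones n" using z w by (auto simp: mod_ones_iff[OF n_pos])
  then show ?thesis by (rule equiv_class_eq[OF equiv_mod_ones[OF n_pos]])
qed

lemma bij_vertex_map:
  assumes \<phi>: "skeleton \<phi>" shows "bij_betw (vertex_map \<phi>) (coxeter_vertices n) (asc_class ` range \<phi>)"
proof (rule bij_betw_imageI)
  have cv: "\<exists>z\<in>int_vectors n. c = mod_ones n `` {z}" if "c \<in> coxeter_vertices n" for c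
    using that by (auto simp: coxeter_vertices_def quotient_def)
  show "inj_on (vertex_map \<phi>) (coxeter_vertices n)"
  proof (rule inj_onI)
    fix c d assume "c \<in> coxeter_vertices n" "d \<in> coxeter_vertices n" and eq: "vertex_map \<phi> c = vertex_map \<phi> d"
    then obtain z w where zw: "z \<in> int_vectors n" "w \<in> int_vectors n"
      "c = mod_ones n `` {z}" "d = mod_ones n `` {w}"
      using cv[of c] cv[of d] by blast
    have "asc_class (\<phi> z) = asc_class (\<phi> w)"
      using eq vertex_map_eq[OF \<phi> zw(1)] vertex_map_eq[OF \<phi> zw(2)] zw(3,4) by simp
    then show "c = d" unfolding zw(3,4) by (rule vertex_map_inj[OF \<phi> zw(1,2)])
  qed
  show "vertex_map \<phi> ` coxeter_vertices n = asc_class ` range \<phi>"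
  proof (intro equalityI subsetI)
    fix v assume "v \<in> vertex_map \<phi> ` coxeter_vertices n"
    then obtain c where "c \<in> coxeter_vertices n" "v = vertex_map \<phi> c" by blast
    then show "v \<in> asc_class ` range \<phi>" using cv[of c] vertex_map_eq[OF \<phi>] by auto
  next
    fix v assume "v \<in> asc_class ` range \<phi>"
    then obtain z where "v = asc_class (\<phi> z)" by blast
    then have "v = vertex_map \<phi> (mod_ones n `` {truncate z})"
      using vertex_map_eq[OF \<phi> truncate_in] skeleton_truncate[OF \<phi>] by simp
    moreover have "mod_ones n `` {truncate z} \<in> coxeter_vertices n"
      unfolding coxeter_vertices_def using truncate_in by (rule quotientI)
    ultimately show "v \<in> vertex_map \<phi> ` coxeter_vertices n" by blast
  qed
qed

lemma vertex_map_iso: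
  assumes \<phi>: "skeleton \<phi>"
  shows "complex_iso (coxeter_vertices n) (coxeter_complex n) (asc_class ` range \<phi>) (short_complex (range \<phi>)) (vertex_map \<phi>)"
  unfolding complex_iso_def
proof (intro conjI allI impI bij_vertex_map[OF \<phi>])
  fix A assume AV: "A \<subseteq> coxeter_vertices n"
  define q where "q z \<sigma> k = (\<lambda>i. z i + indic (\<sigma> ` {1..k}) i)" for z :: "nat \<Rightarrow> int" and \<sigma> :: "nat \<Rightarrow> nat" and k
  have chamber: "coxeter_chamber n z \<sigma> = (\<lambda>k. mod_ones n `` {q z \<sigma> k}) ` {..<n}"
    if "\<sigma> permutes {1..n}" for z \<sigma>
    unfolding coxeter_chamber_def sum_unit_vec[OF permutes_inj[OF that]] q_def by auto
  have q_in: "q z \<sigma> k \<in> int_vectors n" if "z \<in> int_vectors n" "\<sigma> permutes {1..n}" "k \<le> n" for z \<sigma> k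
  proof -
    have "\<sigma> ` {1..k} \<subseteq> {1..n}" using permutes_image[OF that(2)] that(3) by force
    then show ?thesis using that(1) by (auto simp: int_vectors_def q_def)
  qed
  show "A \<in> coxeter_complex n \<longleftrightarrow> vertex_map \<phi> ` A \<in> short_complex (range \<phi>)"
  proof
    assume "A \<in> coxeter_complex n"
    then obtain z \<sigma> where z: "z \<in> int_vectors n" "\<sigma> permutes {1..n}" "A \<subseteq> coxeter_chamber n z \<sigma>"
      by (auto simp: coxeter_complex_def)
    then obtain K where K: "K \<subseteq> {..<n}" "A = (\<lambda>k. mod_ones n `` {q z \<sigma> k}) ` K"
      unfolding chamber[OF z(2)] subset_image_iff by blast
    define S where "S = (\<lambda>k. \<phi> (q z \<sigma> k)) ` K"
    have "vertex_map \<phi> ` A = asc_class ` S"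
      unfolding K(2) S_def image_image
      using K(1) vertex_map_eq[OF \<phi> q_in[OF z(1,2)]] by (intro image_cong) auto
    moreover have "short_set S" unfolding S_def q_def by (rule short_set_chamber[OF \<phi>])
    moreover have "finite S" using K(1) finite_subset by (auto simp: S_def)
    ultimately show "vertex_map \<phi> ` A \<in> short_complex (range \<phi>)"
      unfolding short_complex_def by (intro CollectI exI[of _ S]) (auto simp: S_def)
  next
    assume "vertex_map \<phi> ` A \<in> short_complex (range \<phi>)"
    then obtain S where S: "vertex_map \<phi> ` A = asc_class ` S" "S \<subseteq> range \<phi>" "finite S" "short_set S"
      by (auto simp: short_complex_def)
    show "A \<in> coxeter_complex n"
    proof (cases "S = {}")
      case True
      then have "A \<subseteq> coxeter_chamber n (\<lambda>_. 0) id" using S(1) by simp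
      moreover have "(\<lambda>_. 0) \<in> int_vectors n" by (simp add: int_vectors_def)
      ultimately show ?thesis unfolding coxeter_complex_def using permutes_id by blast
    next
      case False
      obtain u \<sigma> where \<sigma>: "\<sigma> permutes {1..n}"
        and u: "\<And>x. x \<in> S \<Longrightarrow> \<exists>k\<le>n. x = \<phi> (\<lambda>i. u i + indic (\<sigma> ` {1..k}) i)"
        using skeleton_short_coordinates[OF \<phi> S(2,3) False S(4)] by blast
      define z where "z = truncate u"
      have z: "z \<in> int_vectors n" unfolding z_def by (rule truncate_in)
      have "A \<subseteq> coxeter_chamber n z \<sigma>"
      proof
        fix c assume c: "c \<in> A"
        then obtain w where w: "w \<in> int_vectors n" "c = mod_ones n `` {w}"
          using AV by (auto simp: coxeter_vertices_def quotient_def)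
        have "asc_class (\<phi> w) \<in> asc_class ` S" using c S(1) vertex_map_eq[OF \<phi> w(1)] w(2) by blast
        then obtain x where x: "x \<in> S" "asc_class (\<phi> w) = asc_class x" by blast
        obtain k where k: "k \<le> n" "x = \<phi> (\<lambda>i. u i + indic (\<sigma> ` {1..k}) i)" using u[OF x(1)] by blast
        have xq: "x = \<phi> (q z \<sigma> k)"
          unfolding k(2) by (intro skeleton_cong[OF \<phi>]) (simp add: q_def z_def truncate_def)
        have "\<exists>l<n. asc_class x = asc_class (\<phi> (q z \<sigma> l))"
        proof (cases "k = n")
          case True
          have "\<phi> (q z \<sigma> n) = \<phi> (\<lambda>i. z i + 1)"
            using permutes_image[OF \<sigma>] by (intro skeleton_cong[OF \<phi>]) (simp add: q_def)
          then have "x = asc_pow 1 (\<phi> z)" using xq True skeleton_shift[OF \<phi>, of z 1] by simp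
          then have "asc_class x = asc_class (\<phi> z)" using asc_class_eq_iff by metis
          moreover have "q z \<sigma> 0 = z" by (simp add: q_def)
          ultimately show ?thesis using n_pos by (intro exI[of _ 0]) simp
        next
          case False
          then show ?thesis using k(1) xq by (intro exI[of _ k]) simp
        qed
        then obtain l where l: "l < n" "asc_class (\<phi> w) = asc_class (\<phi> (q z \<sigma> l))" using x(2) by auto
        have "c = mod_ones n `` {q z \<sigma> l}"
          unfolding w(2) using l by (intro vertex_map_inj[OF \<phi> w(1)] q_in z \<sigma>) auto
        then show "c \<in> coxeter_chamber n z \<sigma>" unfolding chamber[OF \<sigma>] using l(1) by blast
      qed
      then show ?thesis unfolding coxeter_complex_def using z \<sigma> by blast
    qed
  qed
qed


section \<open>The building axioms\<close>

lemma common_vertex: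
  assumes \<phi>: "skeleton \<phi>" and \<chi>: "skeleton \<chi>" and v: "v \<in> asc_class ` range \<phi>" "v \<in> asc_class ` range \<chi>"
  shows "\<exists>x. v = asc_class x \<and> x \<in> range \<phi> \<and> x \<in> range \<chi>"
proof -
  obtain x y where xy: "v = asc_class x" "x \<in> range \<phi>" "v = asc_class y" "y \<in> range \<chi>" using v by blast
  then obtain k where "y = asc_pow k x" using asc_class_eq_iff by metis
  then have "x \<in> range \<chi>" using xy(4) skeleton_range_pow[OF \<chi>, of k x] by simp
  then show ?thesis using xy(1,2) by (intro exI[of _ x]) simp
qed

text \<open>
  After reparametrization of \<open>\<chi>\<close>, both skeletons have the same values along the chamber of \<open>\<phi>\<close>. The
  isomorphism matches coordinates, and common vertices have the same coordinates.
\<close>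

lemma apartment_iso:
  assumes \<phi>: "skeleton \<phi>" and \<chi>: "skeleton \<chi>"
    and sub: "(\<lambda>k. asc_class (\<phi> (indic {1..k}))) ` {..<n} \<subseteq> asc_class ` range \<chi>"
  shows "\<exists>f. complex_iso (asc_class ` range \<phi>) (short_complex (range \<phi>)) (asc_class ` range \<chi>) (short_complex (range \<chi>)) f
    \<and> (\<forall>v \<in> asc_class ` range \<phi> \<inter> asc_class ` range \<chi>. f v = v)"
proof -
  have in\<chi>: "x \<in> range \<chi>" if "asc_class x \<in> asc_class ` range \<chi>" for x
  proof -
    obtain y where y: "y \<in> range \<chi>" "asc_class x = asc_class y" using \<open>asc_class x \<in> _\<close> by blast
    then obtain k where "y = asc_pow k x" using asc_class_eq_iff by blast
    then have "asc_pow k x \<in> range \<chi>" using y(1) by simp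
    then show ?thesis using skeleton_range_pow[OF \<chi>, of k x] by simp
  qed
  have "\<phi> (indic {1..k}) \<in> range \<chi>" if "k \<le> n" for k
  proof (cases "k = n")
    case True
    have "\<phi> (indic {1..n}) = \<phi> (\<lambda>i. indic {1..0} i + 1)" by (intro skeleton_cong[OF \<phi>]) simp
    then have "\<phi> (indic {1..n}) = asc_pow 1 (\<phi> (indic {1..0}))" by (simp only: skeleton_shift[OF \<phi>])
    moreover have "\<phi> (indic {1..0}) \<in> range \<chi>"
      by (rule in\<chi>, rule subsetD[OF sub], rule image_eqI[of _ _ 0]) (use n_pos in auto)
    ultimately show ?thesis using True skeleton_range_pow[OF \<chi>] by simp
  next
    case False
    then show ?thesis using that sub by (intro in\<chi>) auto
  qed
  then obtain \<psi> where \<psi>: "skeleton \<psi>" "range \<psi> = range \<chi>" "\<And>k. k \<le> n \<Longrightarrow> \<psi> (indic {1..k}) = \<phi> (indic {1..k})"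
    using skeleton_align[OF \<phi> \<chi>] by blast
  define f where "f = vertex_map \<psi> \<circ> inv_into (coxeter_vertices n) (vertex_map \<phi>)"
  have "complex_iso (asc_class ` range \<phi>) (short_complex (range \<phi>)) (asc_class ` range \<chi>) (short_complex (range \<chi>)) f"
    unfolding f_def \<psi>(2)[symmetric]
    by (rule complex_iso_comp[OF complex_iso_inv[OF vertex_map_iso[OF \<phi>]] vertex_map_iso[OF \<psi>(1)]])
  moreover have "f v = v" if v: "v \<in> asc_class ` range \<phi> \<inter> asc_class ` range \<chi>" for v
  proof -
    obtain x where x: "v = asc_class x" "x \<in> range \<phi>" "x \<in> range \<psi>"
      using common_vertex[OF \<phi> \<chi>, of v] v unfolding \<psi>(2) by auto
    then obtain u w where uw: "x = \<phi> u" "x = \<psi> w" by blast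
    have "u i = w i" if "i \<in> {1..n}" for i
      using skeleton_coordinates_unique[OF \<psi>(1) \<phi>, of w u i] \<psi>(3) uw that by simp
    then have "\<psi> u = x" unfolding uw(2) by (intro skeleton_cong[OF \<psi>(1)])
    define c where "c = mod_ones n `` {truncate u}"
    have "c \<in> coxeter_vertices n"
      unfolding coxeter_vertices_def c_def using truncate_in by (rule quotientI)
    moreover have "vertex_map \<phi> c = v" "vertex_map \<psi> c = v"
      unfolding c_def
      using vertex_map_eq[OF \<phi> truncate_in[of u]] vertex_map_eq[OF \<psi>(1) truncate_in[of u]]
        skeleton_truncate[OF \<phi>, of u] skeleton_truncate[OF \<psi>(1), of u] x(1) uw(1) \<open>\<psi> u = x\<close> by simp_all
    ultimately show ?thesis
      using inv_into_f_f[OF bij_betw_imp_inj_on[OF bij_vertex_map[OF \<phi>]], of c] by (simp add: f_def)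
  qed
  ultimately show ?thesis by blast
qed

text \<open>
  The skeleton \<open>\<chi>\<close> contains a chamber of \<open>\<phi>\<close> around \<open>A\<close> and a chamber of \<open>\<psi>\<close> around \<open>B\<close>. The
  isomorphisms from the apartments of \<open>\<phi>\<close> and \<open>\<psi>\<close> to that of \<open>\<chi>\<close> fix all common vertices; the vertices of
  \<open>A\<close> and \<open>B\<close> lie in all three apartments.
\<close>

lemma apartments_iso:
  assumes \<phi>: "skeleton \<phi>" and \<psi>: "skeleton \<psi>"
    and A: "A \<in> short_complex (range \<phi>)" "A \<in> short_complex (range \<psi>)"
    and B: "B \<in> short_complex (range \<phi>)" "B \<in> short_complex (range \<psi>)"
  shows "\<exists>f. complex_iso (asc_class ` range \<phi>) (short_complex (range \<phi>)) (asc_class ` range \<psi>) (short_complex (range \<psi>)) f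
    \<and> (\<forall>v\<in>A \<union> B. f v = v)"
proof -
  define ch where "ch \<xi> = (\<lambda>k. \<xi> (indic {1..k})) ` {..<n}" for \<xi> :: "(nat \<Rightarrow> int) \<Rightarrow> 'a"
  obtain \<phi>' where \<phi>': "skeleton \<phi>'" "range \<phi>' = range \<phi>" "A \<subseteq> asc_class ` ch \<phi>'"
    using short_complex_chamber[OF \<phi> A(1)] unfolding ch_def image_image by blast
  obtain \<psi>' where \<psi>': "skeleton \<psi>'" "range \<psi>' = range \<psi>" "B \<subseteq> asc_class ` ch \<psi>'"
    using short_complex_chamber[OF \<psi> B(2)] unfolding ch_def image_image by blast
  have short: "short_set (ch \<xi>)" if "skeleton \<xi>" for \<xi>
    using short_set_chamber[OF that, of "\<lambda>_. 0" id "{..<n}"] unfolding ch_def by simp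
  have fin: "finite (ch \<xi>)" for \<xi> by (simp add: ch_def)
  obtain \<chi> where \<chi>: "skeleton \<chi>" "ch \<phi>' \<union> ch \<psi>' \<subseteq> range \<chi>"
    using common_skeleton[OF fin short[OF \<phi>'(1)] fin short[OF \<psi>'(1)]] by blast
  have sub: "(\<lambda>k. asc_class (\<phi>' (indic {1..k}))) ` {..<n} \<subseteq> asc_class ` range \<chi>"
    "(\<lambda>k. asc_class (\<psi>' (indic {1..k}))) ` {..<n} \<subseteq> asc_class ` range \<chi>"
    using \<chi>(2) unfolding ch_def by blast+
  obtain f where f: "complex_iso (asc_class ` range \<phi>) (short_complex (range \<phi>)) (asc_class ` range \<chi>) (short_complex (range \<chi>)) f"
    "\<forall>v\<in>asc_class ` range \<phi> \<inter> asc_class ` range \<chi>. f v = v"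
    using apartment_iso[OF \<phi>'(1) \<chi>(1) sub(1)] unfolding \<phi>'(2) by (elim exE conjE)
  obtain g where g: "complex_iso (asc_class ` range \<psi>) (short_complex (range \<psi>)) (asc_class ` range \<chi>) (short_complex (range \<chi>)) g"
    "\<forall>v\<in>asc_class ` range \<psi> \<inter> asc_class ` range \<chi>. g v = v"
    using apartment_iso[OF \<psi>'(1) \<chi>(1) sub(2)] unfolding \<psi>'(2) by (elim exE conjE)
  define h where "h = inv_into (asc_class ` range \<psi>) g \<circ> f"
  have "complex_iso (asc_class ` range \<phi>) (short_complex (range \<phi>)) (asc_class ` range \<psi>) (short_complex (range \<psi>)) h"
    unfolding h_def by (rule complex_iso_comp[OF f(1) complex_iso_inv[OF g(1)]])
  moreover have "h v = v" if v: "v \<in> A \<union> B" for v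
  proof -
    have v\<phi>\<psi>: "v \<in> asc_class ` range \<phi>" "v \<in> asc_class ` range \<psi>"
      using v A B Union_short_complex[of "range \<phi>"] Union_short_complex[of "range \<psi>"] by blast+
    have v\<chi>: "v \<in> asc_class ` range \<chi>" using v \<phi>'(3) \<psi>'(3) \<chi>(2) by blast
    have "inj_on g (asc_class ` range \<psi>)" using g(1) by (simp add: complex_iso_def bij_betw_def)
    then have "inv_into (asc_class ` range \<psi>) g v = v"
      using inv_into_f_f[of g _ v] g(2) v\<chi> v\<phi>\<psi>(2) by simp
    then show ?thesis using f(2) v\<phi>\<psi>(1) v\<chi> by (simp add: h_def)
  qed
  ultimately show ?thesis by blast
qed

lemma simplices_in_apartment:
  assumes "A \<in> short_complex UNIV" "B \<in> short_complex UNIV"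
  shows "\<exists>\<phi>. skeleton \<phi> \<and> A \<in> short_complex (range \<phi>) \<and> B \<in> short_complex (range \<phi>)"
proof -
  obtain S T where S: "A = asc_class ` S" "finite S" "short_set S" and T: "B = asc_class ` T" "finite T" "short_set T"
    using assms by (auto simp: short_complex_def)
  then obtain \<phi> where "skeleton \<phi>" "S \<union> T \<subseteq> range \<phi>" using common_skeleton by blast
  then show ?thesis using S T unfolding short_complex_def by blast
qed

lemma short_complex_building: "affine_building_A n (range asc_class) (short_complex UNIV)"
  unfolding affine_building_A_def
proof (intro conjI exI[of _ "{short_complex (range \<phi>) |\<phi>. skeleton \<phi>}"] ballI allI impI)
  show "simplicial_complex (range asc_class) (short_complex UNIV)" by (rule simplicial_short_complex) simp
  fix \<Sigma> assume "\<Sigma> \<in> {short_complex (range \<phi>) |\<phi>. skeleton \<phi>}"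
  then obtain \<phi> where \<phi>: "skeleton \<phi>" "\<Sigma> = short_complex (range \<phi>)" by blast
  show "subcomplex \<Sigma> (short_complex UNIV)"
    unfolding subcomplex_def \<phi>(2) Union_short_complex
    by (intro conjI simplicial_short_complex) (auto simp: short_complex_def)
  show "\<exists>f. complex_iso (\<Union> \<Sigma>) \<Sigma> (coxeter_vertices n) (coxeter_complex n) f"
    unfolding \<phi>(2) Union_short_complex using complex_iso_inv[OF vertex_map_iso[OF \<phi>(1)]] by blast
  fix \<Sigma>' A B assume "\<Sigma>' \<in> {short_complex (range \<phi>) |\<phi>. skeleton \<phi>}"
    and AB: "A \<in> \<Sigma> \<and> B \<in> \<Sigma> \<and> A \<in> \<Sigma>' \<and> B \<in> \<Sigma>'"
  then obtain \<psi> where \<psi>: "skeleton \<psi>" "\<Sigma>' = short_complex (range \<psi>)" by blast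
  show "\<exists>f. complex_iso (\<Union> \<Sigma>) \<Sigma> (\<Union> \<Sigma>') \<Sigma>' f \<and> (\<forall>v\<in>A \<union> B. f v = v)"
    using apartments_iso[OF \<phi>(1) \<psi>(1)] AB unfolding \<phi>(2) \<psi>(2) Union_short_complex by blast
next
  fix A B assume "A \<in> short_complex UNIV" "B \<in> short_complex UNIV"
  then obtain \<phi> where \<phi>: "skeleton \<phi>" "A \<in> short_complex (range \<phi>)" "B \<in> short_complex (range \<phi>)"
    using simplices_in_apartment by blast
  then show "\<exists>\<Sigma>\<in>{short_complex (range \<phi>) |\<phi>. skeleton \<phi>}. A \<in> \<Sigma> \<and> B \<in> \<Sigma>"
    by (intro bexI[of _ "short_complex (range \<phi>)"] conjI CollectI exI[of _ \<phi>] refl)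
qed

text \<open>
  A simplex lies in an apartment, where it is part of a chamber with \<open>n\<close> vertices. These are distinct
  because their heights are distinct modulo \<open>n\<close>, and powers of \<open>asc\<close> change heights by multiples of \<open>n\<close>.
\<close>

lemma short_complex_dimension: "has_dimension (short_complex UNIV) (int n - 1)"
  unfolding has_dimension_def
proof (intro conjI ballI)
  fix A assume A: "A \<in> short_complex UNIV"
  then obtain \<phi> where "skeleton \<phi>" "A \<in> short_complex (range \<phi>)" using simplices_in_apartment by blast
  then obtain \<psi> where "A \<subseteq> (\<lambda>k. asc_class (\<psi> (indic {1..k}))) ` {..<n}"
    using short_complex_chamber by blast
  then have "card A \<le> card ((\<lambda>k. asc_class (\<psi> (indic {1..k}))) ` {..<n})" by (intro card_mono) simp_all
  also have "\<dots> \<le> n" using card_image_le[of "{..<n}" "\<lambda>k. asc_class (\<psi> (indic {1..k}))"] by simp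
  finally show "int (card A) - 1 \<le> int n - 1" by simp
  show "finite A" using A by (auto simp: short_complex_def)
next
  obtain \<phi> where \<phi>: "skeleton \<phi>" using skeleton_exists by blast
  define p where "p k = \<phi> (indic {1..k})" for k
  have height: "height (p k) = height (\<phi> (\<lambda>_. 0)) + int k" if "k < n" for k
    using skeleton_height[OF \<phi>, of "indic {1..k}"] sum_indic[of k] that by (simp add: p_def)
  have "inj_on (\<lambda>k. asc_class (p k)) {..<n}"
  proof (rule inj_onI)
    fix k l assume kl: "k \<in> {..<n}" "l \<in> {..<n}" "asc_class (p k) = asc_class (p l)"
    then obtain m where "p l = asc_pow m (p k)" using asc_class_eq_iff by blast
    then have "height (p l) = height (p k) + m * int n" using height_asc_pow by simp
    then have l: "int l = int k + m * int n" using kl height by simp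
    then have "int l mod int n = int k mod int n" by simp
    then show "k = l" using kl by simp
  qed
  then have "card (asc_class ` p ` {..<n}) = n" using card_image[of "\<lambda>k. asc_class (p k)" "{..<n}"] by (simp add: image_image)
  moreover have "short_set (p ` {..<n})"
    using short_set_chamber[OF \<phi>, of "\<lambda>_. 0" id "{..<n}"] unfolding p_def by simp
  then have "asc_class ` p ` {..<n} \<in> short_complex UNIV" unfolding short_complex_def by blast
  ultimately show "\<exists>A\<in>short_complex UNIV. int (card A) - 1 = int n - 1" by (intro bexI[of _ "asc_class ` p ` {..<n}"]) simp_all
qed

end

theorem theorem3p6:
  fixes n :: nat
  assumes "finite_rank_intervals TYPE('a::lattice)"
    and "uniform_modular_lattice TYPE('a)"
    and "uniform_rank TYPE('a) = n"
    and "n \<ge> 2"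
  shows "affine_building_A n (lattice_complex_vertices TYPE('a)) (lattice_complex TYPE('a))
    \<and> has_dimension (lattice_complex TYPE('a)) (int n - 1)"
proof -
  have "modular_lattice TYPE('a)"
    using assms(2) unfolding uniform_modular_lattice_def by (rule conjunct1)
  moreover have "1 \<le> n" using assms(4) by simp
  ultimately interpret uniform_modular "TYPE('a)" n
    using assms(1-3) by unfold_locales
  show ?thesis
    unfolding lattice_complex_vertices_eq lattice_complex_eq using short_complex_building short_complex_dimension by blast
qed

end
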